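(* Consider a branching random walk with $\Phi(0)\in(0,\infty]$, $\Phi(1)=0$ and $\Phi$ finite in a neighborhood of $1$. Suppose $\Phi'(1)<0$ and set $$\kappa := \inf\{\theta>1:\Phi(\theta)\ge 0\}\in(1,\infty].$$ Let $\gamma\in(1,\kappa)$. If $W_1=\sum_{|u|=1}e^{-V(u)}$ admits a finite exponential moment (i.e. $\mathbb{E}[e^{\delta W_1}]<\infty$ for some $\delta>0$), then there are constants $C,c>0$ such that $$\mathbb{P}\big(W^{(x)}_n>y\big)\le C\,e^{-\gamma x}\,e^{-cy}$$ for all $x>0$, $y\ge 1$ and $n\in\mathbb{N}\cup\{\infty\}$.
   Context: Branching random walk: let $\Xi$ be a point process on $\mathbb{R}$. The process starts with a single particle (the root $\rho$) at the origin at generation $0$. At each generation $n\ge1$, every particle of generation $n-1$ dies and is replaced, independently of the others, by a random (possibly infinite) number of offspring whose displacements from the parent are distributed as $\Xi$. The genealogical tree is $\mathcal{T}$. For $u\in\mathcal{T}$, $V(u)$ is its position, $|u|$ its generation, $[\rho,u]$ the set of ancestors of $u$ including $u$ itself, and $\underline{V}(u):=\min\{V(v):v\in[\rho,u]\}$. Log-Laplace transform: $\Phi(\theta):=\ln\mathbb{E}\big[\sum_{|u|=1}e^{-\theta V(u)}\big]\in(-\infty,\infty]$. Truncated additive martingale: for $n\ge0$ and $x\ge0$, $$W_n^{(x)}:=\sum_{|u|=n}e^{-(x+V(u))}\mathbf{1}_{\{x+\underline{V}(u)\ge0\}}.$$ For each $x\ge0$ this is a non-negative supermartingale, and $W_\infty^{(x)}$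 denotes its almost sure limit as $n\to\infty$. *)

theory Defs
  imports "HOL-Probability.Probability" "HOL-Library.Sublist"
begin

text \<open>The measurable space of Borel measures on the line, with the \<open>\<sigma>\<close>-algebra generated by the
  evaluations at Borel sets. This is the analogue of \<^const>\<open>subprob_algebra\<close> for measures of
  arbitrary, possibly infinite, mass.\<close>

definition random_measure_algebra :: "real measure measure" where
  "random_measure_algebra =
    (SUP B \<in> sets (borel :: real measure).
       vimage_algebra {\<mu> :: real measure. sets \<mu> = sets borel} (\<lambda>\<mu>. emeasure \<mu> B) borel)"

definition point_process :: "'v measure \<Rightarrow> ('v \<Rightarrow> real measure) \<Rightarrow> bool" where
  "point_process Q \<Xi> \<longleftrightarrow>
     prob_space Q \<and> \<Xi> \<in> measurable Q random_measure_algebra \<and>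
     (AE \<omega> in Q. \<forall>B\<in>sets borel. bounded B \<longrightarrow> (\<exists>k::nat. emeasure (\<Xi> \<omega>) B = of_nat k))"

text \<open>Particles carry Ulam--Harris labels: the root is \<open>[]\<close> and the children of \<open>u\<close> are
  \<open>u @ [i]\<close> for \<open>i < N u \<omega>\<close>. The number \<open>N u \<omega>\<close> of children may be infinite, and
  \<open>X u i \<omega>\<close> is the displacement of \<open>u @ [i]\<close> from \<open>u\<close>. The marks \<open>N u\<close>, \<open>X u i\<close> exist for all labels
  \<open>u\<close>, \<open>i\<close>; those that do not belong to an actual particle are never used.

  The offspring point process of \<open>u\<close>, i.e. the sum of the Dirac masses at the displacements of the
  children of \<open>u\<close>, is the image of the counting measure on the child indices.\<close>

definition offspring_process ::
  "(nat list \<Rightarrow> 'w \<Rightarrow> enat) \<Rightarrow> (nat list \<Rightarrow> nat \<Rightarrow> 'w \<Rightarrow> real) \<Rightarrow> nat list \<Rightarrow> 'w \<Rightarrow> real measure" where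
  "offspring_process N X u \<omega> = distr (count_space {i. enat i < N u \<omega>}) borel (\<lambda>i. X u i \<omega>)"

locale branching_random_walk = prob_space M
  for M :: "'w measure"
    and N :: "nat list \<Rightarrow> 'w \<Rightarrow> enat"
    and X :: "nat list \<Rightarrow> nat \<Rightarrow> 'w \<Rightarrow> real"
    and Q :: "'v measure"
    and \<Xi> :: "'v \<Rightarrow> real measure" +
  assumes point_process_Xi: "point_process Q \<Xi>"
    and indep_offspring:
      "indep_vars (\<lambda>_. count_space UNIV \<Otimes>\<^sub>M Pi\<^sub>M UNIV (\<lambda>_. borel))
         (\<lambda>u \<omega>. (N u \<omega>, \<lambda>i. X u i \<omega>)) UNIV"
    and distr_offspring:
      "\<And>u. distr M random_measure_algebra (offspring_process N X u) =
            distr Q random_measure_algebra \<Xi>"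

definition tree :: "(nat list \<Rightarrow> 'w \<Rightarrow> enat) \<Rightarrow> 'w \<Rightarrow> nat list set" where
  "tree N \<omega> = {u. \<forall>k<length u. enat (u ! k) < N (take k u) \<omega>}"

definition generation :: "(nat list \<Rightarrow> 'w \<Rightarrow> enat) \<Rightarrow> nat \<Rightarrow> 'w \<Rightarrow> nat list set" where
  "generation N n \<omega> = {u \<in> tree N \<omega>. length u = n}"

definition pos :: "(nat list \<Rightarrow> nat \<Rightarrow> 'w \<Rightarrow> real) \<Rightarrow> nat list \<Rightarrow> 'w \<Rightarrow> real" where
  "pos X u \<omega> = (\<Sum>k<length u. X (take k u) (u ! k) \<omega>)"

definition min_pos :: "(nat list \<Rightarrow> nat \<Rightarrow> 'w \<Rightarrow> real) \<Rightarrow> nat list \<Rightarrow> 'w \<Rightarrow> real" where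
  "min_pos X u \<omega> = Min ((\<lambda>v. pos X v \<omega>) ` set (prefixes u))"

definition ln_ennreal :: "ennreal \<Rightarrow> ereal" where
  "ln_ennreal a = (if a = 0 then -\<infinity> else if a = \<infinity> then \<infinity> else ereal (ln (enn2real a)))"

definition exp_ennreal :: "ennreal \<Rightarrow> ennreal" where
  "exp_ennreal a = (if a = \<infinity> then \<infinity> else ennreal (exp (enn2real a)))"

definition log_laplace ::
  "'w measure \<Rightarrow> (nat list \<Rightarrow> 'w \<Rightarrow> enat) \<Rightarrow> (nat list \<Rightarrow> nat \<Rightarrow> 'w \<Rightarrow> real) \<Rightarrow> real \<Rightarrow> ereal" where
  "log_laplace M N X \<theta> =
     ln_ennreal (\<integral>\<^sup>+\<omega>. (\<Sum>\<^sub>\<infinity>u\<in>generation N 1 \<omega>. ennreal (exp (- \<theta> * pos X u \<omega>))) \<partial>M)"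

definition kappa ::
  "'w measure \<Rightarrow> (nat list \<Rightarrow> 'w \<Rightarrow> enat) \<Rightarrow> (nat list \<Rightarrow> nat \<Rightarrow> 'w \<Rightarrow> real) \<Rightarrow> ereal" where
  "kappa M N X = (INF \<theta> \<in> {\<theta>. 1 < \<theta> \<and> 0 \<le> log_laplace M N X \<theta>}. ereal \<theta>)"

definition additive_martingale ::
  "(nat list \<Rightarrow> 'w \<Rightarrow> enat) \<Rightarrow> (nat list \<Rightarrow> nat \<Rightarrow> 'w \<Rightarrow> real) \<Rightarrow> nat \<Rightarrow> 'w \<Rightarrow> ennreal" where
  "additive_martingale N X n \<omega> = (\<Sum>\<^sub>\<infinity>u\<in>generation N n \<omega>. ennreal (exp (- pos X u \<omega>)))"

definition truncated_martingale ::
  "(nat list \<Rightarrow> 'w \<Rightarrow> enat) \<Rightarrow> (nat list \<Rightarrow> nat \<Rightarrow> 'w \<Rightarrow> real) \<Rightarrow> real \<Rightarrow> nat \<Rightarrow> 'w \<Rightarrow> ennreal" where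
  "truncated_martingale N X x n \<omega> =
     (\<Sum>\<^sub>\<infinity>u\<in>generation N n \<omega>.
        ennreal (exp (- (x + pos X u \<omega>))) * indicator {v. 0 \<le> x + min_pos X v \<omega>} u)"

text \<open>The same process indexed by \<open>\<nat> \<union> {\<infinity>}\<close>. The value at \<open>\<infinity>\<close> is the almost sure limit, with the
  convention that it is \<open>0\<close> on the null event where the limit does not exist.\<close>

definition truncated_martingale_ext ::
  "(nat list \<Rightarrow> 'w \<Rightarrow> enat) \<Rightarrow> (nat list \<Rightarrow> nat \<Rightarrow> 'w \<Rightarrow> real) \<Rightarrow> real \<Rightarrow> enat \<Rightarrow> 'w \<Rightarrow> ennreal" where
  "truncated_martingale_ext N X x n \<omega> =
     (case n of
        enat m \<Rightarrow> truncated_martingale N X x m \<omega>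
      | \<infinity> \<Rightarrow> if convergent (\<lambda>m. truncated_martingale N X x m \<omega>)
             then lim (\<lambda>m. truncated_martingale N X x m \<omega>) else 0)"

end

theory Submission
  imports Defs
begin

text \<open>
  Attach to a particle \<open>u\<close> a non-negative weight \<open>w\<close> depending on \<open>x + V(u)\<close> and on the minimum of
  \<open>x + V\<close> along the ancestry of \<open>u\<close>. If replacing one particle by its offspring does not increase the
  expected exponential of the total weight, then the exponential of the total weight of generation
  \<open>n\<close> has expectation at most the exponential of the weight of the root, for every \<open>n\<close>.

  Because \<open>\<Phi>(1) = 0\<close> and \<open>\<Phi>(\<theta>) < 0\<close> for \<open>1 < \<theta> < \<kappa>\<close>, the weight \<open>a (e\<^sup>-\<^sup>z + e\<^sup>-\<^sup>\<theta>\<^sup>z)\<close>, killed below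
  \<open>0\<close>, has this property for small \<open>a\<close>: the term in \<open>\<theta>\<close> contributes a negative drift which absorbs the
  second-order term of the exponential. This gives exponential tails of \<open>W\<^sub>n\<close>, uniformly in \<open>x\<close> and
  \<open>n\<close>, but only a prefactor \<open>e\<^sup>-\<^sup>x\<close>.

  To reach \<open>e\<^sup>-\<^sup>\<gamma>\<^sup>x\<close> fix \<open>g\<close> with \<open>\<gamma> < g < \<kappa>\<close> and a barrier \<open>L\<close>, and split \<open>W\<^sub>n\<close> according to whether the
  ancestral path stays above \<open>L\<close>. The part staying above \<open>L\<close> is \<open>e\<^sup>-\<^sup>L\<close> times the same sum started from
  \<open>x - L\<close>, so its tail at \<open>y\<close> decays like \<open>exp (- a e\<^sup>L y / 2)\<close>. For the other part the weight can be
  taken to be \<open>2 a e\<^sup>-\<^sup>g\<^sup>(\<^sup>z\<^sup>-\<^sup>L\<^sup>)\<close> above the barrier. With \<open>e\<^sup>L\<close> a multiple of \<open>1 + x\<close>, the first part is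
  below \<open>e\<^sup>-\<^sup>\<gamma>\<^sup>x\<^sup>-\<^sup>y\<close> and the second loses a factor \<open>(1 + x)\<^sup>g\<close>, absorbed by \<open>\<gamma> < g\<close>.
\<close>

section \<open>Sums over generations and canonical marks\<close>

text \<open>Labels outside the tree get weight 0, so sums over the random generation become sums
  over deterministic sets of labels. The second argument of \<open>w\<close> carries the running
  minimum, which makes position and minimum together Markovian along a branch.\<close>

definition weight ::
  "(real \<Rightarrow> real \<Rightarrow> real) \<Rightarrow> real \<Rightarrow> (nat list \<Rightarrow> 'w \<Rightarrow> enat) \<Rightarrow> (nat list \<Rightarrow> nat \<Rightarrow> 'w \<Rightarrow> real) \<Rightarrow>
     nat list \<Rightarrow> 'w \<Rightarrow> real" where
  "weight w x N X u \<omega> =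
     (if u \<in> tree N \<omega> then w (x + pos X u \<omega>) (x + min_pos X u \<omega>) else 0)"

text \<open>A function of one mark \<open>b\<close> alone, so that it can be integrated over a fresh
  mark with the parent's position and minimum frozen. \<open>J\<close> cuts the possibly infinite
  offspring down to finitely many indices.\<close>

definition offspring_weight ::
  "(real \<Rightarrow> real \<Rightarrow> real) \<Rightarrow> nat set \<Rightarrow> real \<Rightarrow> real \<Rightarrow> enat \<times> (nat \<Rightarrow> real) \<Rightarrow> real" where
  "offspring_weight w J p m b =
     (\<Sum>i\<in>J. if enat i < fst b then w (p + snd b i) (min m (p + snd b i)) else 0)"

text \<open>Finite deterministic windows that exhaust all labels of length \<open>n\<close> as
  \<open>k\<close> grows; they keep every sum real-valued until the final passage to the
  limit.\<close>

definition words :: "nat \<Rightarrow> nat \<Rightarrow> nat list set" where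
  "words n k = {u. set u \<subseteq> {..<k} \<and> length u = n}"

lemma finite_words [simp]: "finite (words n k)"
  unfolding words_def by (rule finite_lists_length_eq) simp

lemma words_0 [simp]: "words 0 k = {[]}"
  by (auto simp: words_def)

lemma words_mono: "k \<le> l \<Longrightarrow> words n k \<subseteq> words n l"
  by (force simp: words_def)

lemma length_words: "u \<in> words n k \<Longrightarrow> length u = n"
  by (simp add: words_def)

lemma sum_words_Suc: "(\<Sum>v\<in>words (Suc n) k. f v) = (\<Sum>u\<in>words n k. \<Sum>i<k. f (u @ [i]))"
proof -
  have "bij_betw (\<lambda>(u, i). u @ [i]) (words n k \<times> {..<k}) (words (Suc n) k)"
    unfolding bij_betw_def
  proof
    show "inj_on (\<lambda>(u, i). u @ [i]) (words n k \<times> {..<k})"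
      by (auto simp: inj_on_def)
    have "v \<in> (\<lambda>(u, i). u @ [i]) ` (words n k \<times> {..<k})" if v: "v \<in> words (Suc n) k" for v
    proof -
      from v obtain u i where "v = u @ [i]"
        by (metis length_Suc_conv_rev length_words)
      with v show ?thesis
        by (auto simp: words_def intro!: image_eqI[of _ _ "(u, i)"])
    qed
    then show "(\<lambda>(u, i). u @ [i]) ` (words n k \<times> {..<k}) = words (Suc n) k"
      by (auto simp: words_def)
  qed
  then have "(\<Sum>v\<in>words (Suc n) k. f v) = (\<Sum>(u, i)\<in>words n k \<times> {..<k}. f (u @ [i]))"
    by (simp add: sum.reindex_bij_betw[where g = f, symmetric] case_prod_unfold)
  then show ?thesis
    by (simp only: sum.cartesian_product)
qed

lemma finite_subset_words:
  assumes "finite F" "\<And>u. u \<in> F \<Longrightarrow> length u = n"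
  obtains k where "F \<subseteq> words n k"
proof
  show "F \<subseteq> words n (Suc (Max (\<Union> (set ` F))))"
    using assms by (auto simp: words_def less_Suc_eq_le intro!: Max_ge)
qed

section \<open>Positions, minima and weights along one edge of the tree\<close>

lemma pos_Nil [simp]: "pos X [] \<omega> = 0"
  by (simp add: pos_def)

lemma min_pos_Nil [simp]: "min_pos X [] \<omega> = 0"
  by (simp add: min_pos_def)

lemma pos_snoc [simp]: "pos X (u @ [i]) \<omega> = pos X u \<omega> + X u i \<omega>"
  by (simp add: pos_def nth_append)

lemma min_pos_snoc [simp]: "min_pos X (u @ [i]) \<omega> = min (min_pos X u \<omega>) (pos X u \<omega> + X u i \<omega>)"
proof -
  have "min_pos X (u @ [i]) \<omega> = Min (insert (pos X (u @ [i]) \<omega>) ((\<lambda>v. pos X v \<omega>) ` set (prefixes u)))"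
    by (simp add: min_pos_def del: in_set_prefixes)
  also have "\<dots> = min (pos X (u @ [i]) \<omega>) (min_pos X u \<omega>)"
    unfolding min_pos_def by (intro Min_insert) auto
  finally show ?thesis
    by (simp add: min.commute)
qed

lemma min_pos_le_pos: "min_pos X u \<omega> \<le> pos X u \<omega>"
  by (induction u rule: rev_induct) simp_all

lemma Nil_in_tree [simp]: "[] \<in> tree N \<omega>"
  by (simp add: tree_def)

lemma snoc_in_tree [simp]: "u @ [i] \<in> tree N \<omega> \<longleftrightarrow> u \<in> tree N \<omega> \<and> enat i < N u \<omega>"
  by (auto simp: tree_def nth_append less_Suc_eq)

lemma weight_Nil [simp]: "weight w x N X [] \<omega> = w x x"
  by (simp add: weight_def)

text \<open>Separates the mark of \<open>u\<close> itself from the data of \<open>u\<close>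
  determined by its strict ancestors; this is the form in which independence is applied.\<close>

lemma sum_weight_snoc:
  "(\<Sum>i\<in>J. weight w x N X (u @ [i]) \<omega>) =
     (if u \<in> tree N \<omega>
      then offspring_weight w J (x + pos X u \<omega>) (x + min_pos X u \<omega>) (N u \<omega>, \<lambda>i. X u i \<omega>) else 0)"
  by (auto simp: weight_def offspring_weight_def add.assoc min_add_distrib_right
      intro!: sum.cong)

text \<open>Pulling the tree functionals back to the space of families of
  marks makes explicit that they depend on the marks of the strict ancestors only.\<close>

definition mark_N :: "nat list \<Rightarrow> (nat list \<Rightarrow> enat \<times> (nat \<Rightarrow> real)) \<Rightarrow> enat" where
  "mark_N u m = fst (m u)"

definition mark_X :: "nat list \<Rightarrow> nat \<Rightarrow> (nat list \<Rightarrow> enat \<times> (nat \<Rightarrow> real)) \<Rightarrow> real" where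
  "mark_X u i m = snd (m u) i"

abbreviation mark_space :: "(enat \<times> (nat \<Rightarrow> real)) measure" where
  "mark_space \<equiv> count_space UNIV \<Otimes>\<^sub>M Pi\<^sub>M UNIV (\<lambda>_. borel)"

definition mark :: "(nat list \<Rightarrow> 'w \<Rightarrow> enat) \<Rightarrow> (nat list \<Rightarrow> nat \<Rightarrow> 'w \<Rightarrow> real) \<Rightarrow>
    'w \<Rightarrow> nat list \<Rightarrow> enat \<times> (nat \<Rightarrow> real)" where
  "mark N X \<omega> u = (N u \<omega>, \<lambda>i. X u i \<omega>)"

lemma tree_mark: "u \<in> tree mark_N (mark N X \<omega>) \<longleftrightarrow> u \<in> tree N \<omega>"
  by (simp add: tree_def mark_N_def mark_def)

lemma pos_mark: "pos mark_X u (mark N X \<omega>) = pos X u \<omega>"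
  by (simp add: pos_def mark_X_def mark_def)

lemma min_pos_mark: "min_pos mark_X u (mark N X \<omega>) = min_pos X u \<omega>"
  by (simp add: min_pos_def pos_mark)

lemma weight_mark: "weight w x mark_N mark_X u (mark N X \<omega>) = weight w x N X u \<omega>"
  by (simp add: weight_def pos_mark min_pos_mark tree_mark)

text \<open>The range \<open>k<length u\<close> excludes \<open>u\<close>: whether \<open>u\<close>
  is alive and where it sits is decided by the marks of its strict ancestors, never by its
  own.\<close>

definition ancestors_in :: "nat list set \<Rightarrow> nat list \<Rightarrow> bool" where
  "ancestors_in K u \<longleftrightarrow> (\<forall>k<length u. take k u \<in> K)"

lemma ancestors_in_snoc: "ancestors_in K (u @ [i]) \<longleftrightarrow> ancestors_in K u \<and> u \<in> K"
  by (auto simp: ancestors_in_def less_Suc_eq)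

lemma
  assumes "ancestors_in K u"
  shows tree_restrict: "u \<in> tree mark_N (restrict m K) \<longleftrightarrow> u \<in> tree mark_N m"
    and pos_restrict: "pos mark_X u (restrict m K) = pos mark_X u m"
    and min_pos_restrict: "min_pos mark_X u (restrict m K) = min_pos mark_X u m"
  using assms
  by (induction u rule: rev_induct) (auto simp: ancestors_in_snoc mark_N_def mark_X_def)

lemma weight_restrict:
  "ancestors_in K u \<Longrightarrow> weight w x mark_N mark_X u (restrict m K) = weight w x mark_N mark_X u m"
  by (simp add: weight_def tree_restrict pos_restrict min_pos_restrict)

section \<open>Measurability of tree functionals in the marks\<close>

lemma measurable_fst_mark [measurable]:
  "Measurable.pred mark_space (\<lambda>b. enat i < fst b)"
  by (rule measurable_compose[OF measurable_fst]) simp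

lemma measurable_snd_mark [measurable]:
  "(\<lambda>b. snd b i) \<in> borel_measurable mark_space"
  by (rule measurable_compose[OF measurable_snd]) simp

lemma
  assumes "ancestors_in K u"
  shows measurable_tree: "Measurable.pred (Pi\<^sub>M K (\<lambda>_. mark_space)) (\<lambda>m. u \<in> tree mark_N m)"
    and measurable_pos: "pos mark_X u \<in> borel_measurable (Pi\<^sub>M K (\<lambda>_. mark_space))"
    and measurable_min_pos: "min_pos mark_X u \<in> borel_measurable (Pi\<^sub>M K (\<lambda>_. mark_space))"
proof -
  have "Measurable.pred (Pi\<^sub>M K (\<lambda>_. mark_space)) (\<lambda>m. u \<in> tree mark_N m) \<and>
    (\<lambda>m. pos mark_X u m) \<in> borel_measurable (Pi\<^sub>M K (\<lambda>_. mark_space)) \<and>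
    (\<lambda>m. min_pos mark_X u m) \<in> borel_measurable (Pi\<^sub>M K (\<lambda>_. mark_space))"
    using assms
  proof (induction u rule: rev_induct)
    case Nil
    then show ?case by simp
  next
    case (snoc i u)
    then have u: "u \<in> K" and
      [measurable]: "Measurable.pred (Pi\<^sub>M K (\<lambda>_. mark_space)) (\<lambda>m. u \<in> tree mark_N m)"
      "(\<lambda>m. pos mark_X u m) \<in> borel_measurable (Pi\<^sub>M K (\<lambda>_. mark_space))"
      "(\<lambda>m. min_pos mark_X u m) \<in> borel_measurable (Pi\<^sub>M K (\<lambda>_. mark_space))"
      by (auto simp: ancestors_in_snoc)
    have [measurable]: "(\<lambda>m. m u) \<in> measurable (Pi\<^sub>M K (\<lambda>_. mark_space)) mark_space"
      using u by (rule measurable_component_singleton)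
    have [measurable]: "Measurable.pred (Pi\<^sub>M K (\<lambda>_. mark_space)) (\<lambda>m. enat i < mark_N u m)"
      "(\<lambda>m. mark_X u i m) \<in> borel_measurable (Pi\<^sub>M K (\<lambda>_. mark_space))"
      unfolding mark_N_def mark_X_def
      using measurable_compose[OF measurable_component_singleton[OF u] measurable_fst_mark]
        measurable_compose[OF measurable_component_singleton[OF u] measurable_snd_mark]
      by simp_all
    show ?case
      by simp
  qed
  then show "Measurable.pred (Pi\<^sub>M K (\<lambda>_. mark_space)) (\<lambda>m. u \<in> tree mark_N m)"
    "pos mark_X u \<in> borel_measurable (Pi\<^sub>M K (\<lambda>_. mark_space))"
    "min_pos mark_X u \<in> borel_measurable (Pi\<^sub>M K (\<lambda>_. mark_space))"
    by auto
qed

lemma measurable_weight: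
  assumes [measurable]: "(\<lambda>(p, m). w p m) \<in> borel_measurable (borel \<Otimes>\<^sub>M borel)"
    and u: "ancestors_in K u"
  shows "weight w x mark_N mark_X u \<in> borel_measurable (Pi\<^sub>M K (\<lambda>_. mark_space))"
proof -
  note [measurable] = measurable_tree[OF u] measurable_pos[OF u] measurable_min_pos[OF u]
  show ?thesis
    unfolding weight_def[abs_def] by measurable
qed

text \<open>By independence the joint law is a product, so Tonelli allows \<open>B\<close> to be
  resampled by a separate variable while \<open>A\<close> is held fixed.\<close>

lemma (in prob_space) nn_integral_indep_var:
  assumes ind: "indep_var S A T B" and f [measurable]: "f \<in> borel_measurable (S \<Otimes>\<^sub>M T)"
  shows "(\<integral>\<^sup>+\<omega>. f (A \<omega>, B \<omega>) \<partial>M) = (\<integral>\<^sup>+\<omega>. (\<integral>\<^sup>+\<omega>'. f (A \<omega>, B \<omega>') \<partial>M) \<partial>M)"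
proof -
  note [measurable] = indep_var_rv1[OF ind] indep_var_rv2[OF ind]
  interpret T: prob_space "distr M T B"
    by (rule prob_space_distr) measurable
  have "(\<integral>\<^sup>+\<omega>. f (A \<omega>, B \<omega>) \<partial>M) = (\<integral>\<^sup>+z. f z \<partial>distr M (S \<Otimes>\<^sub>M T) (\<lambda>\<omega>. (A \<omega>, B \<omega>)))"
    by (simp add: nn_integral_distr)
  also have "\<dots> = (\<integral>\<^sup>+z. f z \<partial>(distr M S A \<Otimes>\<^sub>M distr M T B))"
    using ind by (simp add: indep_var_distribution_eq)
  also have "\<dots> = (\<integral>\<^sup>+a. \<integral>\<^sup>+b. f (a, b) \<partial>distr M T B \<partial>distr M S A)"
    by (rule T.nn_integral_fst[symmetric]) simp
  also have "\<dots> = (\<integral>\<^sup>+\<omega>. \<integral>\<^sup>+b. f (A \<omega>, b) \<partial>distr M T B \<partial>M)"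
    by (rule nn_integral_distr) measurable
  also have "\<dots> = (\<integral>\<^sup>+\<omega>. (\<integral>\<^sup>+\<omega>'. f (A \<omega>, B \<omega>') \<partial>M) \<partial>M)"
  proof (rule nn_integral_cong)
    fix \<omega> assume "\<omega> \<in> space M"
    then have "A \<omega> \<in> space S"
      using indep_var_rv1[OF ind] by (rule measurable_space[rotated])
    then show "(\<integral>\<^sup>+b. f (A \<omega>, b) \<partial>distr M T B) = (\<integral>\<^sup>+\<omega>'. f (A \<omega>, B \<omega>') \<partial>M)"
      by (intro nn_integral_distr) measurable
  qed
  finally show ?thesis .
qed

section \<open>Subinvariant weights\<close>

lemma measurable_offspring_weight:
  assumes [measurable]: "(\<lambda>(p, m). w p m) \<in> borel_measurable (borel \<Otimes>\<^sub>M borel)"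
    and [measurable]: "f \<in> borel_measurable S" "g \<in> borel_measurable S" "h \<in> measurable S mark_space"
  shows "(\<lambda>z. offspring_weight w J (f z) (g z) (h z)) \<in> borel_measurable S"
proof -
  have [measurable]: "Measurable.pred S (\<lambda>z. enat i < fst (h z))" for i
    by (rule measurable_compose[OF _ measurable_fst_mark]) measurable
  have [measurable]: "(\<lambda>z. snd (h z) i) \<in> borel_measurable S" for i
    by (rule measurable_compose[OF _ measurable_snd_mark]) measurable
  show ?thesis
    unfolding offspring_weight_def by measurable
qed

context branching_random_walk
begin

lemma indep_marks: "indep_vars (\<lambda>_. mark_space) (\<lambda>u \<omega>. mark N X \<omega> u) UNIV"
  using indep_offspring by (simp add: mark_def)

lemma measurable_N [measurable]: "N u \<in> measurable M (count_space UNIV)"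
proof -
  have "(\<lambda>\<omega>. mark N X \<omega> u) \<in> measurable M mark_space"
    using indep_marks by (simp add: indep_vars_def)
  from measurable_compose[OF this measurable_fst] show ?thesis
    by (simp add: mark_def)
qed

lemma measurable_X [measurable]: "X u i \<in> borel_measurable M"
proof -
  have "(\<lambda>\<omega>. mark N X \<omega> u) \<in> measurable M mark_space"
    using indep_marks by (simp add: indep_vars_def)
  from measurable_compose[OF this measurable_snd_mark[of i]] show ?thesis
    by (simp add: mark_def)
qed

lemma measurable_mark [measurable]:
  "(\<lambda>\<omega>. mark N X \<omega>) \<in> measurable M (Pi\<^sub>M UNIV (\<lambda>_. mark_space))"
proof (rule measurable_PiM_single')
  show "(\<lambda>\<omega>. mark N X \<omega> u) \<in> measurable M mark_space" for u
    using indep_marks by (simp add: indep_vars_def)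
qed (auto simp: space_pair_measure space_PiM)

lemma measurable_weight' [measurable (raw)]:
  assumes "(\<lambda>(p, m). w p m) \<in> borel_measurable (borel \<Otimes>\<^sub>M borel)"
  shows "weight w x N X u \<in> borel_measurable M"
proof -
  have "ancestors_in UNIV u"
    by (simp add: ancestors_in_def)
  from measurable_compose[OF measurable_mark measurable_weight[OF assms this, of x]] show ?thesis
    by (simp add: weight_mark)
qed

text \<open>Quantified over \<open>u\<close> because marks at different labels may have different
  laws, and over finite \<open>J\<close> because of the cut-off. The restriction
  \<open>m \<le> p\<close> matches \<open>min_pos_le_pos\<close>.\<close>

definition subinvariant :: "(real \<Rightarrow> real \<Rightarrow> real) \<Rightarrow> bool" where
  "subinvariant w \<longleftrightarrow> (\<forall>u J p m. finite J \<longrightarrow> m \<le> p \<longrightarrow>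
     (\<integral>\<^sup>+\<omega>. ennreal (exp (offspring_weight w J p m (mark N X \<omega> u))) \<partial>M) \<le> ennreal (exp (w p m)))"

text \<open>Condition on all marks except that of \<open>u\<close>. No other term in the exponent
  involves this mark, so the inner integral over it is the one-step expectation, which
  \<open>subinvariant\<close> bounds by the exponential of the weight of \<open>u\<close>.\<close>

lemma nn_integral_replace_label:
  assumes w [measurable]: "(\<lambda>(p, m). w p m) \<in> borel_measurable (borel \<Otimes>\<^sub>M borel)"
    and sub: "subinvariant w" and J: "finite J"
    and FG: "\<And>v. v \<in> F \<union> G \<Longrightarrow> length v = length u" "u \<notin> F \<union> G"
  shows "(\<integral>\<^sup>+\<omega>. ennreal (exp ((\<Sum>v\<in>G. weight w x N X v \<omega>) +
            (\<Sum>v\<in>F. \<Sum>i\<in>J. weight w x N X (v @ [i]) \<omega>) + (\<Sum>i\<in>J. weight w x N X (u @ [i]) \<omega>))) \<partial>M)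
     \<le> (\<integral>\<^sup>+\<omega>. ennreal (exp ((\<Sum>v\<in>G. weight w x N X v \<omega>) +
            (\<Sum>v\<in>F. \<Sum>i\<in>J. weight w x N X (v @ [i]) \<omega>) + weight w x N X u \<omega>)) \<partial>M)"
proof -
  define K where "K = - {u}"
  define A where "A = (\<lambda>\<omega>. restrict (mark N X \<omega>) K)"
  define B where "B = (\<lambda>\<omega>. restrict (mark N X \<omega>) {u})"
  let ?S = "Pi\<^sub>M K (\<lambda>_. mark_space)"
  let ?T = "Pi\<^sub>M {u} (\<lambda>_. mark_space)"
  have ind: "indep_var ?S A ?T B"
    unfolding A_def B_def K_def by (rule indep_var_restrict[OF indep_marks]) auto
  \<comment> \<open>A label is never a strict ancestor of a label of the same length. A child of
    some \<open>v\<close> in \<open>F\<close> has only \<open>v\<close> as further ancestor, and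
    \<open>v\<close> differs from \<open>u\<close>.\<close>
  have anc: "ancestors_in K v" if "length v = length u" for v
    using that by (auto simp: ancestors_in_def K_def)
  have anc': "ancestors_in K (v @ [i])" if "v \<in> F" for v i
    using that FG anc by (auto simp: ancestors_in_snoc K_def)
  note [measurable] = measurable_tree[OF anc[OF refl]] measurable_pos[OF anc[OF refl]]
    measurable_min_pos[OF anc[OF refl]]
  define R where "R = (\<lambda>m. (\<Sum>v\<in>G. weight w x mark_N mark_X v m) +
    (\<Sum>v\<in>F. \<Sum>i\<in>J. weight w x mark_N mark_X (v @ [i]) m))"
  have [measurable]: "R \<in> borel_measurable ?S"
    unfolding R_def using FG anc anc' w
    by (intro borel_measurable_add borel_measurable_sum measurable_weight) auto
  have R: "R (A \<omega>) = (\<Sum>v\<in>G. weight w x N X v \<omega>) +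
      (\<Sum>v\<in>F. \<Sum>i\<in>J. weight w x N X (v @ [i]) \<omega>)" for \<omega>
    unfolding R_def A_def using FG anc anc'
    by (intro arg_cong2[where f = "(+)"] sum.cong) (auto simp: weight_restrict weight_mark)
  define V where "V = (\<lambda>(a, b). if u \<in> tree mark_N a
    then offspring_weight w J (x + pos mark_X u a) (x + min_pos mark_X u a) (b u) else 0)"
  have [measurable]: "V \<in> borel_measurable (?S \<Otimes>\<^sub>M ?T)"
    unfolding V_def case_prod_unfold by (intro measurable_If measurable_offspring_weight[OF w]) measurable
  have A: "u \<in> tree mark_N (A \<omega>) \<longleftrightarrow> u \<in> tree N \<omega>" "pos mark_X u (A \<omega>) = pos X u \<omega>"
    "min_pos mark_X u (A \<omega>) = min_pos X u \<omega>" for \<omega>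
    using anc[OF refl]
    by (simp_all add: A_def tree_restrict tree_mark pos_restrict pos_mark min_pos_restrict min_pos_mark)
  have V: "(\<Sum>i\<in>J. weight w x N X (u @ [i]) \<omega>) = V (A \<omega>, B \<omega>)" for \<omega>
    by (simp add: V_def A B_def sum_weight_snoc mark_def)
  have "(\<integral>\<^sup>+\<omega>. ennreal (exp (R (A \<omega>) + V (A \<omega>, B \<omega>))) \<partial>M) =
      (\<integral>\<^sup>+\<omega>. (\<integral>\<^sup>+\<omega>'. ennreal (exp (R (A \<omega>) + V (A \<omega>, B \<omega>'))) \<partial>M) \<partial>M)"
    using nn_integral_indep_var[OF ind, of "\<lambda>z. ennreal (exp (R (fst z) + V z))"] by simp
  also have "\<dots> \<le> (\<integral>\<^sup>+\<omega>. ennreal (exp (R (A \<omega>) + weight w x N X u \<omega>)) \<partial>M)"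
  proof (rule nn_integral_mono)
    fix \<omega> assume "\<omega> \<in> space M"
    have [measurable]: "B \<in> measurable M ?T"
      using indep_var_rv2[OF ind] .
    have "A \<omega> \<in> space ?S"
      using indep_var_rv1[OF ind] \<open>\<omega> \<in> space M\<close> by (rule measurable_space)
    then have [measurable]: "(\<lambda>\<omega>'. V (A \<omega>, B \<omega>')) \<in> borel_measurable M"
      by measurable
    have *: "(\<integral>\<^sup>+\<omega>'. ennreal (exp (V (A \<omega>, B \<omega>'))) \<partial>M) \<le> ennreal (exp (weight w x N X u \<omega>))"
    proof (cases "u \<in> tree N \<omega>")
      case True
      then show ?thesis
        using sub J min_pos_le_pos[of X u \<omega>]
        by (simp add: V_def A B_def weight_def subinvariant_def)
    next
      case False
      then show ?thesis
        by (simp add: V_def A weight_def emeasure_space_1)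
    qed
    have "(\<integral>\<^sup>+\<omega>'. ennreal (exp (R (A \<omega>) + V (A \<omega>, B \<omega>'))) \<partial>M) =
        ennreal (exp (R (A \<omega>))) * (\<integral>\<^sup>+\<omega>'. ennreal (exp (V (A \<omega>, B \<omega>'))) \<partial>M)"
      by (simp add: exp_add ennreal_mult nn_integral_cmult)
    also have "\<dots> \<le> ennreal (exp (R (A \<omega>))) * ennreal (exp (weight w x N X u \<omega>))"
      using * by (rule mult_left_mono) simp
    finally show "(\<integral>\<^sup>+\<omega>'. ennreal (exp (R (A \<omega>) + V (A \<omega>, B \<omega>'))) \<partial>M)
        \<le> ennreal (exp (R (A \<omega>) + weight w x N X u \<omega>))"
      by (simp add: exp_add ennreal_mult)
  qed
  finally show ?thesis
    by (simp add: R V)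
qed

text \<open>The labels of \<open>F\<close> are exchanged one at a time, each exchange of the
  children of a label for the label itself only increasing the integral.\<close>

lemma nn_integral_generation_step:
  assumes w: "(\<lambda>(p, m). w p m) \<in> borel_measurable (borel \<Otimes>\<^sub>M borel)"
    and sub: "subinvariant w" and J: "finite J" and F: "finite F" "\<And>v. v \<in> F \<Longrightarrow> length v = n"
  shows "(\<integral>\<^sup>+\<omega>. ennreal (exp (\<Sum>v\<in>F. \<Sum>i\<in>J. weight w x N X (v @ [i]) \<omega>)) \<partial>M)
     \<le> (\<integral>\<^sup>+\<omega>. ennreal (exp (\<Sum>v\<in>F. weight w x N X v \<omega>)) \<partial>M)"
proof -
  \<comment> \<open>Generalised for the induction: \<open>G\<close> collects the labels already
    exchanged, which enter with their own weight.\<close>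
  have "(\<integral>\<^sup>+\<omega>. ennreal (exp ((\<Sum>v\<in>G. weight w x N X v \<omega>) +
            (\<Sum>v\<in>F. \<Sum>i\<in>J. weight w x N X (v @ [i]) \<omega>))) \<partial>M)
     \<le> (\<integral>\<^sup>+\<omega>. ennreal (exp (\<Sum>v\<in>G \<union> F. weight w x N X v \<omega>)) \<partial>M)"
    if "finite G" "G \<inter> F = {}" "\<And>v. v \<in> G \<Longrightarrow> length v = n" for G
    using F that
  proof (induction F arbitrary: G rule: finite_induct)
    case empty
    then show ?case by simp
  next
    case (insert u F)
    have len: "length u = n" "\<And>v. v \<in> F \<union> G \<Longrightarrow> length v = n"
      using insert.prems by auto
    have "(\<integral>\<^sup>+\<omega>. ennreal (exp ((\<Sum>v\<in>G. weight w x N X v \<omega>) +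
            (\<Sum>v\<in>insert u F. \<Sum>i\<in>J. weight w x N X (v @ [i]) \<omega>))) \<partial>M) =
      (\<integral>\<^sup>+\<omega>. ennreal (exp ((\<Sum>v\<in>G. weight w x N X v \<omega>) +
            (\<Sum>v\<in>F. \<Sum>i\<in>J. weight w x N X (v @ [i]) \<omega>) + (\<Sum>i\<in>J. weight w x N X (u @ [i]) \<omega>))) \<partial>M)"
      using insert.hyps by (simp add: add_ac)
    also have "\<dots> \<le> (\<integral>\<^sup>+\<omega>. ennreal (exp ((\<Sum>v\<in>G. weight w x N X v \<omega>) +
            (\<Sum>v\<in>F. \<Sum>i\<in>J. weight w x N X (v @ [i]) \<omega>) + weight w x N X u \<omega>)) \<partial>M)"
      using insert.hyps insert.prems len by (intro nn_integral_replace_label w sub J) auto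
    also have "\<dots> = (\<integral>\<^sup>+\<omega>. ennreal (exp ((\<Sum>v\<in>insert u G. weight w x N X v \<omega>) +
            (\<Sum>v\<in>F. \<Sum>i\<in>J. weight w x N X (v @ [i]) \<omega>))) \<partial>M)"
      using insert.prems by (simp add: add_ac)
    also have "\<dots> \<le> (\<integral>\<^sup>+\<omega>. ennreal (exp (\<Sum>v\<in>insert u G \<union> F. weight w x N X v \<omega>)) \<partial>M)"
      using insert.hyps insert.prems len by (intro insert.IH) auto
    finally show ?case
      by simp
  qed
  from this[of "{}"] show ?thesis
    by simp
qed

text \<open>Going back one generation at a time, with child indices \<open>{..<k}\<close>, ends at
  the root. The bound does not depend on \<open>n\<close> or \<open>k\<close>.\<close>

lemma exp_moment_generation:
  assumes w: "(\<lambda>(p, m). w p m) \<in> borel_measurable (borel \<Otimes>\<^sub>M borel)"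
    and sub: "subinvariant w"
  shows "(\<integral>\<^sup>+\<omega>. ennreal (exp (\<Sum>v\<in>words n k. weight w x N X v \<omega>)) \<partial>M) \<le> ennreal (exp (w x x))"
proof (induction n)
  case 0
  then show ?case
    by (simp add: emeasure_space_1)
next
  case (Suc n)
  have "(\<integral>\<^sup>+\<omega>. ennreal (exp (\<Sum>v\<in>words (Suc n) k. weight w x N X v \<omega>)) \<partial>M)
      \<le> (\<integral>\<^sup>+\<omega>. ennreal (exp (\<Sum>v\<in>words n k. weight w x N X v \<omega>)) \<partial>M)"
    unfolding sum_words_Suc using length_words by (intro nn_integral_generation_step w sub) auto
  also note Suc.IH
  finally show ?case .
qed

end

section \<open>The law of the offspring process\<close>

lemma measurable_emeasure_random_measure_algebra [measurable]:
  "B \<in> sets borel \<Longrightarrow> (\<lambda>\<mu>. emeasure \<mu> B) \<in> borel_measurable random_measure_algebra"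
  by (auto intro!: measurable_Sup1 measurable_vimage_algebra1 simp: random_measure_algebra_def)

lemma space_random_measure_algebra: "space random_measure_algebra = {\<mu>. sets \<mu> = sets borel}"
  by (auto simp add: random_measure_algebra_def space_Sup_eq_UN)

lemma measurable_random_measure_algebra:
  "(\<And>a. a \<in> space M \<Longrightarrow> sets (K a) = sets borel) \<Longrightarrow>
   (\<And>B. B \<in> sets borel \<Longrightarrow> (\<lambda>a. emeasure (K a) B) \<in> borel_measurable M) \<Longrightarrow>
   K \<in> measurable M random_measure_algebra"
  by (auto intro!: measurable_Sup2 measurable_vimage_algebra2 simp: random_measure_algebra_def)

lemma nn_integral_measurable_random_measure_algebra:
  fixes h :: "real \<Rightarrow> ennreal"
  assumes "h \<in> borel_measurable borel"
  shows "(\<lambda>\<mu>. \<integral>\<^sup>+y. h y \<partial>\<mu>) \<in> borel_measurable random_measure_algebra" (is "_ \<in> ?B")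
  using assms
proof induct
  case (cong f g)
  then show ?case
    by simp
next
  case (set B)
  then have "(\<lambda>\<mu>. \<integral>\<^sup>+y. indicator B y \<partial>\<mu>) \<in> ?B \<longleftrightarrow> (\<lambda>\<mu>. emeasure \<mu> B) \<in> ?B"
    by (intro measurable_cong nn_integral_indicator) (simp add: space_random_measure_algebra)
  with set show ?case
    by simp
next
  case (mult f c)
  then have "(\<lambda>\<mu>. \<integral>\<^sup>+y. c * f y \<partial>\<mu>) \<in> ?B \<longleftrightarrow> (\<lambda>\<mu>. c * \<integral>\<^sup>+y. f y \<partial>\<mu>) \<in> ?B"
    by (intro measurable_cong nn_integral_cmult)
       (auto simp: space_random_measure_algebra cong: measurable_cong_sets)
  with mult show ?case
    by simp
next
  case (add f g)
  then have "(\<lambda>\<mu>. \<integral>\<^sup>+y. f y + g y \<partial>\<mu>) \<in> ?B \<longleftrightarrow> (\<lambda>\<mu>. (\<integral>\<^sup>+y. f y \<partial>\<mu>) + (\<integral>\<^sup>+y. g y \<partial>\<mu>)) \<in> ?B"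
    by (intro measurable_cong nn_integral_add)
       (auto simp: space_random_measure_algebra cong: measurable_cong_sets)
  with add show ?case
    by (simp add: ac_simps)
next
  case (seq F)
  then have "(\<lambda>\<mu>. \<integral>\<^sup>+y. (SUP i. F i) y \<partial>\<mu>) \<in> ?B \<longleftrightarrow> (\<lambda>\<mu>. SUP i. (\<integral>\<^sup>+y. F i y \<partial>\<mu>)) \<in> ?B"
    unfolding SUP_apply
    by (intro measurable_cong nn_integral_monotone_convergence_SUP)
       (auto simp: space_random_measure_algebra cong: measurable_cong_sets)
  with seq show ?case
    by (simp add: ac_simps)
qed

lemma infsum_ennreal_eq_suminf:
  fixes f :: "nat \<Rightarrow> ennreal"
  shows "(\<Sum>\<^sub>\<infinity>i\<in>A. f i) = (\<Sum>i. if i \<in> A then f i else 0)"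
proof -
  have "(\<Sum>\<^sub>\<infinity>i\<in>A. f i) = (\<Sum>\<^sub>\<infinity>i. if i \<in> A then f i else 0)"
    by (rule infsum_cong_neutral) auto
  also have "((\<lambda>i. if i \<in> A then f i else 0) has_sum (\<Sum>\<^sub>\<infinity>i. if i \<in> A then f i else 0)) UNIV"
    by (intro has_sum_infsum nonneg_summable_on_complete) simp
  then have "(\<Sum>\<^sub>\<infinity>i. if i \<in> A then f i else 0) = (\<Sum>i. if i \<in> A then f i else 0)"
    by (intro sums_unique has_sum_imp_sums)
  finally show ?thesis .
qed

lemma generation_1: "generation N 1 \<omega> = (\<lambda>i. [i]) ` {i. enat i < N [] \<omega>}"
  by (auto simp: generation_def tree_def length_Suc_conv)

section \<open>Extended logarithm and exponential, and elementary inequalities\<close>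

lemma ln_ennreal_eq_0: "ln_ennreal a = 0 \<longleftrightarrow> a = 1"
proof (cases a)
  case (real r)
  then show ?thesis
    by (cases "r = 0") (auto simp: ln_ennreal_def zero_ereal_def ennreal_eq_1)
qed (simp add: ln_ennreal_def)

lemma ln_ennreal_neg: "ln_ennreal a < 0 \<longleftrightarrow> a < 1"
proof (cases a)
  case (real r)
  then show ?thesis
    by (cases "r = 0") (auto simp: ln_ennreal_def zero_ereal_def ennreal_less_one_iff)
qed (simp add: ln_ennreal_def)

lemma exp_ennreal_mono: "a \<le> b \<Longrightarrow> exp_ennreal a \<le> exp_ennreal b"
  by (auto simp: exp_ennreal_def top_unique less_top intro!: ennreal_leI enn2real_mono)

lemma exp_ennreal_ennreal: "0 \<le> t \<Longrightarrow> exp_ennreal (ennreal t) = ennreal (exp t)"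
  by (simp add: exp_ennreal_def)

lemma measurable_exp_ennreal [measurable]: "exp_ennreal \<in> borel_measurable borel"
  unfolding exp_ennreal_def[abs_def] by measurable

text \<open>Multiply \<open>1 - t \<le> exp (- t)\<close> by \<open>(1 + t) * exp t\<close>. The
  remainder is later controlled by the exponential moment of \<open>W_1\<close>.\<close>

lemma exp_le_second_order:
  fixes t :: real
  assumes "0 \<le> t"
  shows "exp t \<le> 1 + t + t\<^sup>2 * exp t"
proof -
  have "1 - t \<le> exp (- t)"
    using exp_ge_add_one_self[of "- t"] by simp
  then have "(1 - t\<^sup>2) * exp t = (1 + t) * ((1 - t) * exp t)"
    by (simp add: algebra_simps power2_eq_square)
  also have "\<dots> \<le> (1 + t) * (exp (- t) * exp t)"
    using assms exp_ge_add_one_self[of "- t"] by (intro mult_left_mono mult_right_mono) auto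
  finally show ?thesis
    by (simp add: algebra_simps flip: exp_add)
qed

text \<open>Follows from \<open>ln s \<le> s - 1\<close> at \<open>s = \<eta> * t\<close> with
  \<open>\<eta> = \<epsilon> / r\<close>; the constant is the power \<open>- r\<close> of
  \<open>\<eta>\<close>.\<close>

lemma powr_le_exp:
  fixes r \<epsilon> :: real
  assumes "0 < r" "0 < \<epsilon>"
  obtains C where "0 < C" "\<And>t. 0 \<le> t \<Longrightarrow> t powr r \<le> C * exp (\<epsilon> * t)"
proof
  define \<eta> where "\<eta> = \<epsilon> / r"
  have \<eta>: "0 < \<eta>" "r * \<eta> = \<epsilon>"
    using assms by (simp_all add: \<eta>_def)
  show "0 < exp (- r * ln \<eta>)"
    by simp
  fix t :: real
  assume "0 \<le> t"
  show "t powr r \<le> exp (- r * ln \<eta>) * exp (\<epsilon> * t)"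
  proof (cases "t = 0")
    case False
    with \<open>0 \<le> t\<close> have t: "0 < t" by simp
    have "ln t + ln \<eta> \<le> \<eta> * t"
      using ln_le_minus_one[of "\<eta> * t"] \<eta> t by (simp add: ln_mult)
    then have "r * (ln t + ln \<eta>) \<le> r * (\<eta> * t)"
      using assms by (intro mult_left_mono) auto
    also have "r * (\<eta> * t) = \<epsilon> * t"
      using \<eta>(2) by (simp flip: mult.assoc)
    finally have "r * ln t \<le> - r * ln \<eta> + \<epsilon> * t"
      by (simp add: distrib_left)
    then show ?thesis
      using t by (simp add: powr_def flip: exp_add)
  qed (use assms in simp)
qed

text \<open>Split off one factor: the remaining power \<open>g - 1\<close> of each term is at most
  that of the total.\<close>

lemma sum_powr_le:
  fixes b :: "'a \<Rightarrow> real"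
  assumes "finite I" "\<And>i. i \<in> I \<Longrightarrow> 0 \<le> b i" "1 \<le> g"
  shows "(\<Sum>i\<in>I. b i powr g) \<le> (\<Sum>i\<in>I. b i) powr g"
proof -
  define B where "B = (\<Sum>i\<in>I. b i)"
  have B: "0 \<le> B"
    using assms by (auto simp: B_def intro: sum_nonneg)
  have powr_split: "c powr g = c * c powr (g - 1)" if "0 \<le> c" for c :: real
    using that powr_add[of c 1 "g - 1"] by (cases "c = 0") auto
  have "b i powr g \<le> b i * B powr (g - 1)" if "i \<in> I" for i
    using assms that member_le_sum[of i I b]
    by (auto simp: powr_split B_def intro!: mult_left_mono powr_mono2)
  then have "(\<Sum>i\<in>I. b i powr g) \<le> (\<Sum>i\<in>I. b i * B powr (g - 1))"
    by (rule sum_mono)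
  also have "\<dots> = B powr g"
    using B by (simp add: powr_split B_def flip: sum_distrib_right)
  finally show ?thesis
    by (simp add: B_def)
qed

section \<open>Offspring functionals and the one-step exponential moment\<close>

context branching_random_walk
begin

definition offspring_sum :: "(real \<Rightarrow> ennreal) \<Rightarrow> nat list \<Rightarrow> 'w \<Rightarrow> ennreal" where
  "offspring_sum h u \<omega> = (\<Sum>i. if enat i < N u \<omega> then h (X u i \<omega>) else 0)"

lemma measurable_alive [measurable]: "Measurable.pred M (\<lambda>\<omega>. enat i < N u \<omega>)"
  by (rule measurable_compose[OF measurable_N]) simp

lemma measurable_offspring_sum [measurable (raw)]:
  assumes [measurable]: "h \<in> borel_measurable borel"
  shows "offspring_sum h u \<in> borel_measurable M"
  unfolding offspring_sum_def[abs_def] by measurable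

text \<open>Exhibits \<open>offspring_sum\<close> as a functional of the offspring point process,
  the only object whose law is prescribed to be the same at every label.\<close>

lemma nn_integral_offspring_process:
  assumes [measurable]: "h \<in> borel_measurable borel"
  shows "(\<integral>\<^sup>+y. h y \<partial>offspring_process N X u \<omega>) = offspring_sum h u \<omega>"
proof -
  have "(\<integral>\<^sup>+y. h y \<partial>offspring_process N X u \<omega>) =
      (\<integral>\<^sup>+i. h (X u i \<omega>) \<partial>count_space {i. enat i < N u \<omega>})"
    unfolding offspring_process_def by (subst nn_integral_distr) auto
  also have "\<dots> = (\<integral>\<^sup>+i. (if enat i < N u \<omega> then h (X u i \<omega>) else 0) \<partial>count_space UNIV)"
    by (subst nn_integral_count_space_indicator) (auto intro!: nn_integral_cong)
  finally show ?thesis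
    by (simp add: offspring_sum_def nn_integral_count_space_nat)
qed

lemma measurable_offspring_process [measurable]:
  "offspring_process N X u \<in> measurable M random_measure_algebra"
proof (rule measurable_random_measure_algebra)
  fix B :: "real set" assume B: "B \<in> sets borel"
  have "emeasure (offspring_process N X u \<omega>) B = offspring_sum (indicator B) u \<omega>" for \<omega>
    using B by (subst nn_integral_offspring_process[symmetric])
      (auto simp: offspring_process_def)
  with B show "(\<lambda>\<omega>. emeasure (offspring_process N X u \<omega>) B) \<in> borel_measurable M"
    by simp
qed (simp add: offspring_process_def)

text \<open>The marks of distinct labels need not be equally distributed, because only the offspring point
  processes are: the children may be enumerated differently at each label. Only functionals
  of the form \<open>\<integral> h d\<xi>\<^sub>u\<close> may be transferred from one label to another.\<close>

lemma offspring_sum_same_law: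
  assumes [measurable]: "h \<in> borel_measurable borel" and G [measurable]: "G \<in> borel_measurable borel"
  shows "(\<integral>\<^sup>+\<omega>. G (offspring_sum h u \<omega>) \<partial>M) = (\<integral>\<^sup>+\<omega>. G (offspring_sum h v \<omega>) \<partial>M)"
proof -
  note [measurable] = nn_integral_measurable_random_measure_algebra[OF assms(1)]
  have "(\<integral>\<^sup>+\<omega>. G (offspring_sum h u \<omega>) \<partial>M) =
      (\<integral>\<^sup>+\<mu>. G (\<integral>\<^sup>+y. h y \<partial>\<mu>) \<partial>distr Q random_measure_algebra \<Xi>)" for u
    by (simp add: nn_integral_offspring_process nn_integral_distr flip: distr_offspring[of u])
  then show ?thesis
    by simp
qed

lemma infsum_generation_1:
  "(\<Sum>\<^sub>\<infinity>v\<in>generation N 1 \<omega>. h (pos X v \<omega>)) = offspring_sum h [] \<omega>"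
proof -
  have "(\<Sum>\<^sub>\<infinity>v\<in>generation N 1 \<omega>. h (pos X v \<omega>)) = (\<Sum>\<^sub>\<infinity>i\<in>{i. enat i < N [] \<omega>}. h (X [] i \<omega>))"
    unfolding generation_1 by (subst infsum_reindex) (auto simp: inj_on_def comp_def pos_def)
  then show ?thesis
    by (simp add: infsum_ennreal_eq_suminf offspring_sum_def)
qed

definition laplace :: "real \<Rightarrow> ennreal" where
  "laplace \<theta> = (\<integral>\<^sup>+\<omega>. offspring_sum (\<lambda>y. ennreal (exp (- \<theta> * y))) [] \<omega> \<partial>M)"

lemma log_laplace_eq: "log_laplace M N X \<theta> = ln_ennreal (laplace \<theta>)"
  unfolding log_laplace_def laplace_def
  by (simp add: infsum_generation_1[where h = "\<lambda>y. ennreal (exp (- \<theta> * y))", simplified])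

lemma additive_martingale_1:
  "additive_martingale N X 1 \<omega> = offspring_sum (\<lambda>y. ennreal (exp (- y))) [] \<omega>"
  unfolding additive_martingale_def by (rule infsum_generation_1)

lemma sum_le_offspring_sum:
  assumes "finite J"
  shows "(\<Sum>i\<in>J. if enat i < N u \<omega> then h (X u i \<omega>) else 0) \<le> offspring_sum h u \<omega>"
  unfolding offspring_sum_def using assms by (intro sum_le_suminf) auto

text \<open>The cut-off \<open>J\<close> refers to the enumeration of the children, so the finite
  sums are first dominated by full offspring sums and only then moved from \<open>u\<close> to the
  root. The linear term costs the Laplace transforms, the second-order term costs the exponential
  moment.\<close>

lemma one_step_exp_moment:
  fixes f :: "real \<Rightarrow> real" and b1 b2 t1 t2 m1 m2 c \<delta> K :: real
  assumes J: "finite J" and [measurable]: "f \<in> borel_measurable borel"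
    and nonneg: "0 \<le> b1" "0 \<le> b2" "0 \<le> m1" "0 \<le> m2" "0 \<le> c" "0 \<le> \<delta>" "0 \<le> K"
    and f: "\<And>y. 0 \<le> f y" "\<And>y. f y \<le> b1 * exp (- t1 * y) + b2 * exp (- t2 * y)"
    and mean: "laplace t1 \<le> ennreal m1" "laplace t2 \<le> ennreal m2"
    and expm: "(\<integral>\<^sup>+\<omega>. exp_ennreal (ennreal \<delta> * additive_martingale N X 1 \<omega>) \<partial>M) \<le> ennreal K"
    and second: "\<And>I Y. finite I \<Longrightarrow> I \<subseteq> J \<Longrightarrow> (\<Sum>i\<in>I. f (Y i))\<^sup>2 * exp (\<Sum>i\<in>I. f (Y i)) \<le>
      c * exp (\<delta> * (\<Sum>i\<in>I. exp (- Y i)))"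
  shows "(\<integral>\<^sup>+\<omega>. ennreal (exp (\<Sum>i\<in>J. if enat i < N u \<omega> then f (X u i \<omega>) else 0)) \<partial>M)
     \<le> ennreal (1 + b1 * m1 + b2 * m2 + c * K)"
proof -
  let ?e = "\<lambda>t y. ennreal (exp (- t * y))"
  define D where "D = (\<lambda>\<omega>. \<Sum>i\<in>J. if enat i < N u \<omega> then exp (- X u i \<omega>) else 0)"
  define S where "S = (\<lambda>\<omega>. \<Sum>i\<in>J. if enat i < N u \<omega> then f (X u i \<omega>) else 0)"
  let ?L = "\<lambda>t \<omega>. offspring_sum (?e t) u \<omega>"
  have nn: "0 \<le> S \<omega>" "0 \<le> D \<omega>" for \<omega>
    by (auto simp: S_def D_def f intro!: sum_nonneg)
  have DL: "ennreal (D \<omega>) \<le> ?L 1 \<omega>" for \<omega>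
  proof -
    have "ennreal (D \<omega>) = (\<Sum>i\<in>J. if enat i < N u \<omega> then ?e 1 (X u i \<omega>) else 0)"
      unfolding D_def by (rule trans[OF sum_ennreal[symmetric] sum.cong]) auto
    also have "\<dots> \<le> ?L 1 \<omega>"
      using J by (rule sum_le_offspring_sum)
    finally show ?thesis .
  qed
  have SL: "ennreal (S \<omega>) \<le> ennreal b1 * ?L t1 \<omega> + ennreal b2 * ?L t2 \<omega>" for \<omega>
  proof -
    have "ennreal (S \<omega>) = (\<Sum>i\<in>J. if enat i < N u \<omega> then ennreal (f (X u i \<omega>)) else 0)"
      unfolding S_def by (rule trans[OF sum_ennreal[symmetric] sum.cong]) (auto simp: f)
    also have "\<dots> \<le> (\<Sum>i\<in>J. ennreal b1 * (if enat i < N u \<omega> then ?e t1 (X u i \<omega>) else 0) +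
        ennreal b2 * (if enat i < N u \<omega> then ?e t2 (X u i \<omega>) else 0))"
      using f(2) nonneg
      by (intro sum_mono) (auto simp flip: ennreal_mult ennreal_plus intro!: ennreal_leI)
    also have "\<dots> \<le> ennreal b1 * ?L t1 \<omega> + ennreal b2 * ?L t2 \<omega>"
      unfolding sum.distrib sum_distrib_left[symmetric]
      using J by (intro add_mono mult_left_mono sum_le_offspring_sum) auto
    finally show ?thesis .
  qed
  have quad: "(S \<omega>)\<^sup>2 * exp (S \<omega>) \<le> c * exp (\<delta> * D \<omega>)" for \<omega>
    using second[of "{i\<in>J. enat i < N u \<omega>}" "\<lambda>i. X u i \<omega>"] J
    by (simp add: S_def D_def sum.inter_filter)
  have "ennreal (exp (S \<omega>)) \<le> 1 + (ennreal b1 * ?L t1 \<omega> + ennreal b2 * ?L t2 \<omega>) +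
      ennreal c * exp_ennreal (ennreal \<delta> * ?L 1 \<omega>)" for \<omega>
  proof -
    have "exp (S \<omega>) \<le> 1 + S \<omega> + c * exp (\<delta> * D \<omega>)"
      using exp_le_second_order[OF nn(1)] quad[of \<omega>] by (smt (verit))
    then have "ennreal (exp (S \<omega>)) \<le> ennreal (1 + S \<omega> + c * exp (\<delta> * D \<omega>))"
      by (rule ennreal_leI)
    also have "\<dots> = 1 + ennreal (S \<omega>) + ennreal c * exp_ennreal (ennreal \<delta> * ennreal (D \<omega>))"
      using nn nonneg by (simp add: ennreal_plus ennreal_mult exp_ennreal_ennreal flip: ennreal_mult)
    also have "\<dots> \<le> 1 + (ennreal b1 * ?L t1 \<omega> + ennreal b2 * ?L t2 \<omega>) +
      ennreal c * exp_ennreal (ennreal \<delta> * ?L 1 \<omega>)"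
      by (intro add_mono mult_left_mono exp_ennreal_mono SL DL) auto
    finally show ?thesis .
  qed
  then have "(\<integral>\<^sup>+\<omega>. ennreal (exp (S \<omega>)) \<partial>M) \<le>
      (\<integral>\<^sup>+\<omega>. 1 + (ennreal b1 * ?L t1 \<omega> + ennreal b2 * ?L t2 \<omega>) +
      ennreal c * exp_ennreal (ennreal \<delta> * ?L 1 \<omega>) \<partial>M)"
    by (rule nn_integral_mono)
  also have "\<dots> = 1 + (ennreal b1 * (\<integral>\<^sup>+\<omega>. ?L t1 \<omega> \<partial>M) + ennreal b2 * (\<integral>\<^sup>+\<omega>. ?L t2 \<omega> \<partial>M)) +
      ennreal c * (\<integral>\<^sup>+\<omega>. exp_ennreal (ennreal \<delta> * ?L 1 \<omega>) \<partial>M)"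
    by (simp add: nn_integral_add nn_integral_cmult emeasure_space_1)
  also have "\<dots> \<le> 1 + (ennreal b1 * ennreal m1 + ennreal b2 * ennreal m2) + ennreal c * ennreal K"
  proof (intro add_mono mult_left_mono)
    have "(\<integral>\<^sup>+\<omega>. ?L t \<omega> \<partial>M) = laplace t" for t
      unfolding laplace_def by (rule offspring_sum_same_law[where G = "\<lambda>a. a"]) measurable
    with mean show "(\<integral>\<^sup>+\<omega>. ?L t1 \<omega> \<partial>M) \<le> ennreal m1" "(\<integral>\<^sup>+\<omega>. ?L t2 \<omega> \<partial>M) \<le> ennreal m2"
      by simp_all
    have "(\<integral>\<^sup>+\<omega>. exp_ennreal (ennreal \<delta> * ?L 1 \<omega>) \<partial>M) =
      (\<integral>\<^sup>+\<omega>. exp_ennreal (ennreal \<delta> * offspring_sum (?e 1) [] \<omega>) \<partial>M)"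
      by (rule offspring_sum_same_law[where G = "\<lambda>a. exp_ennreal (ennreal \<delta> * a)"]) measurable
    with expm show "(\<integral>\<^sup>+\<omega>. exp_ennreal (ennreal \<delta> * ?L 1 \<omega>) \<partial>M) \<le> ennreal K"
      by (simp add: additive_martingale_1[unfolded One_nat_def])
  qed auto
  also have "\<dots> = ennreal (1 + b1 * m1 + b2 * m2 + c * K)"
    using nonneg by (simp add: ennreal_plus ennreal_mult add.assoc)
  finally show ?thesis
    by (simp add: S_def)
qed

end

section \<open>Killed and barrier weights\<close>

definition killed_weight :: "real \<Rightarrow> real \<Rightarrow> real \<Rightarrow> real \<Rightarrow> real" where
  "killed_weight a \<theta> p m = (if 0 \<le> m then a * (exp (- p) + exp (- \<theta> * p)) else 0)"

text \<open>Once a path has gone below \<open>L\<close> it keeps the killed weight for good. The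
  factor 2 makes the value at \<open>L\<close> dominate \<open>killed_weight\<close> at all
  non-negative positions, so crossing the barrier gains nothing.\<close>

definition barrier_weight :: "real \<Rightarrow> real \<Rightarrow> real \<Rightarrow> real \<Rightarrow> real \<Rightarrow> real \<Rightarrow> real" where
  "barrier_weight a \<theta> g L p m =
     (if L \<le> m then 2 * a * exp (- g * (p - L)) else killed_weight a \<theta> p m)"

lemma measurable_killed_weight:
  "(\<lambda>(p, m). killed_weight a \<theta> p m) \<in> borel_measurable (borel \<Otimes>\<^sub>M borel)"
  unfolding killed_weight_def by measurable

lemma measurable_barrier_weight:
  "(\<lambda>(p, m). barrier_weight a \<theta> g L p m) \<in> borel_measurable (borel \<Otimes>\<^sub>M borel)"
  unfolding barrier_weight_def killed_weight_def by measurable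

lemma killed_weight_nonneg: "0 \<le> a \<Longrightarrow> 0 \<le> killed_weight a \<theta> p m"
  by (simp add: killed_weight_def)

lemma killed_weight_le:
  assumes "0 \<le> a" "1 \<le> \<theta>" "m \<le> p"
  shows "killed_weight a \<theta> p m \<le> 2 * a * exp (- p)"
proof (cases "0 \<le> m")
  case True
  with assms have "1 * p \<le> \<theta> * p"
    by (intro mult_right_mono) auto
  then have "a * (exp (- p) + exp (- \<theta> * p)) \<le> a * (exp (- p) + exp (- p))"
    using assms by (intro mult_left_mono add_left_mono) auto
  with True show ?thesis
    by (simp add: killed_weight_def)
qed (use assms in \<open>simp add: killed_weight_def\<close>)

lemma killed_weight_ge: "0 \<le> a \<Longrightarrow> 0 \<le> m \<Longrightarrow> a * exp (- p) \<le> killed_weight a \<theta> p m"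
  by (simp add: killed_weight_def distrib_left)

context branching_random_walk
begin

text \<open>The first exponential is conserved in mean, the second loses
  \<open>(1 - m1) * a * exp (- \<theta> * p)\<close>. The second-order term has size
  \<open>a\<^sup>2 * exp (- 2 * p)\<close>, which this loss covers for small \<open>a\<close> since
  \<open>\<theta> \<le> 2\<close> and \<open>p\<close> is non-negative.\<close>

lemma killed_weight_step:
  fixes \<delta> K C a \<theta> m1 p m :: real
  assumes J: "finite J" and a: "0 < a" and \<theta>: "1 \<le> \<theta>" "\<theta> \<le> 2"
    and lap: "laplace 1 = 1" "laplace \<theta> \<le> ennreal m1" "0 \<le> m1"
    and expm: "(\<integral>\<^sup>+\<omega>. exp_ennreal (ennreal \<delta> * additive_martingale N X 1 \<omega>) \<partial>M) \<le> ennreal K"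
      "0 \<le> \<delta>" "0 \<le> K"
    and C: "0 < C" "\<And>t. 0 \<le> t \<Longrightarrow> t powr 2 \<le> C * exp (\<delta> / 2 * t)"
    and small: "4 * a \<le> \<delta>" "4 * a * C * K \<le> 1 - m1"
    and pm: "0 \<le> m" "m \<le> p"
  shows "(\<integral>\<^sup>+\<omega>. ennreal (exp (offspring_weight (killed_weight a \<theta>) J p m (mark N X \<omega> u))) \<partial>M)
    \<le> ennreal (exp (killed_weight a \<theta> p m))"
proof -
  define f where "f = (\<lambda>y. killed_weight a \<theta> (p + y) (p + y))"
  have [measurable]: "f \<in> borel_measurable borel"
    unfolding f_def killed_weight_def by measurable
  \<comment> \<open>Since \<open>m\<close> is non-negative, a child is killed exactly when its own
    position is negative.\<close>
  have ow: "offspring_weight (killed_weight a \<theta>) J p m (mark N X \<omega> u) =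
      (\<Sum>i\<in>J. if enat i < N u \<omega> then f (X u i \<omega>) else 0)" for \<omega>
    using pm by (auto simp: offspring_weight_def mark_def f_def killed_weight_def intro!: sum.cong)
  have f0: "0 \<le> f y" for y
    using a by (simp add: f_def killed_weight_nonneg)
  have f1: "f y \<le> a * exp (- p) * exp (- 1 * y) + a * exp (- \<theta> * p) * exp (- \<theta> * y)" for y
    using a by (simp add: f_def killed_weight_def algebra_simps flip: exp_add)
  have f2: "f y \<le> 2 * a * exp (- p) * exp (- y)" for y
    using killed_weight_le[of a \<theta> "p + y" "p + y"] a \<theta> by (simp add: f_def mult.assoc flip: exp_add)
  let ?c = "4 * a\<^sup>2 * exp (- 2 * p) * C"
  have second: "(\<Sum>i\<in>I. f (Y i))\<^sup>2 * exp (\<Sum>i\<in>I. f (Y i)) \<le> ?c * exp (\<delta> * (\<Sum>i\<in>I. exp (- Y i)))"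
    for I :: "nat set" and Y
  proof -
    define S D where "S = (\<Sum>i\<in>I. f (Y i))" and "D = (\<Sum>i\<in>I. exp (- Y i))"
    have D: "0 \<le> D" and S: "0 \<le> S"
      using f0 by (auto simp: S_def D_def intro: sum_nonneg)
    have SD: "S \<le> 2 * a * exp (- p) * D"
      unfolding S_def D_def sum_distrib_left by (rule sum_mono) (rule f2)
    also have "\<dots> \<le> 2 * a * 1 * D"
      using a D pm by (intro mult_right_mono mult_left_mono) auto
    also have "\<dots> \<le> \<delta> / 2 * D"
      using small D by (intro mult_right_mono) auto
    finally have S': "S \<le> \<delta> / 2 * D" .
    have "S\<^sup>2 \<le> (2 * a * exp (- p) * D)\<^sup>2"
      using SD S by (rule power_mono)
    also have "\<dots> = 4 * a\<^sup>2 * exp (- 2 * p) * D powr 2"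
      using D by (simp add: power_mult_distrib powr_numeral flip: exp_double)
    also have "\<dots> \<le> 4 * a\<^sup>2 * exp (- 2 * p) * (C * exp (\<delta> / 2 * D))"
      using C D by (intro mult_left_mono) auto
    \<comment> \<open>Half of the exponent \<open>\<delta>\<close> absorbs the power of
      \<open>D\<close>, the other half absorbs \<open>exp S\<close>. The factor
      \<open>exp (- p)\<close> is kept in the square but dropped in the exponential.\<close>
    finally have "S\<^sup>2 * exp S \<le> 4 * a\<^sup>2 * exp (- 2 * p) * (C * exp (\<delta> / 2 * D)) * exp (\<delta> / 2 * D)"
      using S' C by (intro mult_mono) auto
    also have "\<dots> = ?c * exp (\<delta> / 2 * D + \<delta> / 2 * D)"
      by (simp only: exp_add mult.assoc)
    finally show ?thesis
      by (simp add: S_def D_def)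
  qed
  have "(\<integral>\<^sup>+\<omega>. ennreal (exp (offspring_weight (killed_weight a \<theta>) J p m (mark N X \<omega> u))) \<partial>M)
    \<le> ennreal (1 + a * exp (- p) * 1 + a * exp (- \<theta> * p) * m1 + ?c * K)"
    unfolding ow using a lap C expm f0 f1 second
    by (intro one_step_exp_moment[OF J, where ?t1.0 = 1 and ?t2.0 = \<theta> and \<delta> = \<delta>]) auto
  also have "\<dots> \<le> ennreal (exp (killed_weight a \<theta> p m))"
  proof (rule ennreal_leI)
    have "?c * K = 4 * a * C * K * (a * exp (- 2 * p))"
      by (simp add: power2_eq_square)
    also have "\<dots> \<le> (1 - m1) * (a * exp (- 2 * p))"
      using small a by (intro mult_right_mono) auto
    also have "\<dots> \<le> (1 - m1) * (a * exp (- \<theta> * p))"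
    proof -
      have "0 \<le> 4 * a * C * K"
        using a C expm by simp
      with small have "0 \<le> 1 - m1" by linarith
      moreover have "\<theta> * p \<le> 2 * p"
        using \<theta> pm by (intro mult_right_mono) auto
      ultimately show ?thesis
        using a by (intro mult_left_mono) auto
    qed
    finally have "1 + a * exp (- p) * 1 + a * exp (- \<theta> * p) * m1 + ?c * K \<le> 1 + killed_weight a \<theta> p m"
      using pm by (simp add: killed_weight_def algebra_simps)
    also have "\<dots> \<le> exp (killed_weight a \<theta> p m)"
      by (rule exp_ge_add_one_self)
    finally show "1 + a * exp (- p) * 1 + a * exp (- \<theta> * p) * m1 + ?c * K \<le> exp (killed_weight a \<theta> p m)" .
  qed
  finally show ?thesis .
qed

text \<open>The mean already contracts by the factor \<open>m2\<close>, so it suffices that the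
  second-order term carries the same decay \<open>exp (- g * q)\<close> with a coefficient of order
  \<open>a\<^sup>2\<close>.\<close>

lemma barrier_weight_step:
  fixes \<delta> K C a \<theta> g L m2 p m :: real
  assumes J: "finite J" and a: "0 < a" and \<theta>: "1 \<le> \<theta>" and g: "1 \<le> g"
    and lap: "laplace g \<le> ennreal m2" "0 \<le> m2"
    and expm: "(\<integral>\<^sup>+\<omega>. exp_ennreal (ennreal \<delta> * additive_martingale N X 1 \<omega>) \<partial>M) \<le> ennreal K"
      "0 \<le> \<delta>" "0 \<le> K"
    and C: "0 < C" "\<And>t. 0 \<le> t \<Longrightarrow> t powr (g + 1) \<le> C * exp (\<delta> / 2 * t)"
    and small: "4 * a \<le> \<delta>" "2 * a * C * K \<le> 1 - m2"
    and pm: "L \<le> m" "m \<le> p"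
  shows "(\<integral>\<^sup>+\<omega>. ennreal (exp (offspring_weight (barrier_weight a \<theta> g L) J p m (mark N X \<omega> u))) \<partial>M)
    \<le> ennreal (exp (barrier_weight a \<theta> g L p m))"
proof -
  define f where "f = (\<lambda>y. barrier_weight a \<theta> g L (p + y) (p + y))"
  define q where "q = p - L"
  have q: "0 \<le> q"
    using pm by (simp add: q_def)
  have [measurable]: "f \<in> borel_measurable borel"
    unfolding f_def killed_weight_def barrier_weight_def by measurable
  have ow: "offspring_weight (barrier_weight a \<theta> g L) J p m (mark N X \<omega> u) =
      (\<Sum>i\<in>J. if enat i < N u \<omega> then f (X u i \<omega>) else 0)" for \<omega>
    using pm by (auto simp: offspring_weight_def mark_def f_def killed_weight_def barrier_weight_def
        min_def intro!: sum.cong)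
  have f0: "0 \<le> f y" for y
    using a by (simp add: f_def killed_weight_nonneg barrier_weight_def)
  \<comment> \<open>Here \<open>b = exp (- (p + y - L))\<close>. Above the barrier \<open>b\<close>
    is at most 1, so its power \<open>g\<close> is the smaller one; below it both powers are at
    least 1 and \<open>f y \<le> 2 * a\<close> is enough.\<close>
  have bound: "f y \<le> 2 * a * b powr g \<and> f y \<le> 2 * a * b" if b: "b = exp (- q) * exp (- y)" for y b
  proof -
    have b': "b = exp (- (p + y - L))"
      by (simp add: b q_def flip: exp_add)
    have powr: "b powr g = exp (- g * (p + y - L))"
      by (simp add: b' powr_def algebra_simps)
    show ?thesis
    proof (cases "L \<le> p + y")
      case True
      then have "1 * (p + y - L) \<le> g * (p + y - L)"
        using g by (intro mult_right_mono) auto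
      then have "b powr g \<le> b"
        unfolding powr unfolding b' by simp
      with True a show ?thesis
        unfolding powr by (simp add: f_def barrier_weight_def)
    next
      case False
      have "f y \<le> 2 * a"
      proof (cases "0 \<le> p + y")
        case True
        have "f y \<le> 2 * a * exp (- (p + y))"
          using False killed_weight_le[of a \<theta> "p + y" "p + y"] a \<theta>
          by (simp add: f_def barrier_weight_def)
        also have "\<dots> \<le> 2 * a * 1"
          using True a by (intro mult_left_mono) auto
        finally show ?thesis
          by simp
      next
        case neg: False
        with False a show ?thesis
          by (simp add: f_def barrier_weight_def killed_weight_def)
      qed
      moreover have "1 \<le> b"
        using False by (simp add: b')
      moreover from this have "1 \<le> b powr g"
        using g by (simp add: ge_one_powr_ge_zero)
      ultimately show ?thesis
        using a by (smt (verit) mult_le_cancel_left1)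
    qed
  qed
  have f1: "f y \<le> 2 * a * exp (- g * q) * exp (- g * y) + 0 * exp (- g * y)" for y
    using bound[OF refl, of y] by (simp add: powr_def algebra_simps flip: exp_add)
  let ?c = "4 * a\<^sup>2 * exp (- g * q) * C"
  have second: "(\<Sum>i\<in>I. f (Y i))\<^sup>2 * exp (\<Sum>i\<in>I. f (Y i)) \<le> ?c * exp (\<delta> * (\<Sum>i\<in>I. exp (- Y i)))"
    if "finite I" for I :: "nat set" and Y
  proof -
    define S D where "S = (\<Sum>i\<in>I. f (Y i))" and "D = (\<Sum>i\<in>I. exp (- Y i))"
    have D: "0 \<le> D" and S: "0 \<le> S"
      using f0 by (auto simp: S_def D_def intro: sum_nonneg)
    have "S \<le> (\<Sum>i\<in>I. 2 * a * (exp (- q) * exp (- Y i)))"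
      unfolding S_def using bound by (intro sum_mono) auto
    also have "\<dots> = 2 * a * exp (- q) * D"
      by (simp add: D_def sum_distrib_left mult.assoc)
    also have "\<dots> \<le> 2 * a * 1 * D"
      using a D q by (intro mult_right_mono mult_left_mono) auto
    finally have S1: "S \<le> 2 * a * D"
      by simp
    also have "\<dots> \<le> \<delta> / 2 * D"
      using small D by (intro mult_right_mono) auto
    finally have S': "S \<le> \<delta> / 2 * D" .
    \<comment> \<open>the embedding of \<open>l\<^sup>1\<close> into \<open>l\<^sup>g\<close> gives \<open>e\<^sup>-\<^sup>g\<^sup>q\<close> without assuming \<open>g \<le> 2\<close>\<close>
    have "S \<le> (\<Sum>i\<in>I. 2 * a * (exp (- q) * exp (- Y i)) powr g)"
      unfolding S_def using bound by (intro sum_mono) auto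
    also have "\<dots> = 2 * a * (\<Sum>i\<in>I. (exp (- q) * exp (- Y i)) powr g)"
      by (rule sum_distrib_left[symmetric])
    also have "\<dots> \<le> 2 * a * (\<Sum>i\<in>I. exp (- q) * exp (- Y i)) powr g"
      using a g that by (intro mult_left_mono sum_powr_le) auto
    also have "\<dots> = 2 * a * (exp (- g * q) * D powr g)"
    proof -
      have "(exp (- q) * D) powr g = exp (- g * q) * D powr g"
        using D by (simp add: powr_mult exp_powr_real mult.commute)
      then show ?thesis
        by (simp add: D_def flip: sum_distrib_left)
    qed
    finally have S2: "S \<le> 2 * a * (exp (- g * q) * D powr g)" .
    \<comment> \<open>One factor takes the linear bound, the other the bound of order
      \<open>g\<close>: this is the origin of the power \<open>g + 1\<close> in the hypothesis on
      \<open>C\<close>.\<close>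
    have "S\<^sup>2 \<le> 2 * a * D * (2 * a * (exp (- g * q) * D powr g))"
      unfolding power2_eq_square using S S1 S2 a D by (intro mult_mono) auto
    also have "\<dots> = 4 * a\<^sup>2 * exp (- g * q) * D powr (g + 1)"
      using D by (simp add: power2_eq_square powr_add)
    also have "\<dots> \<le> 4 * a\<^sup>2 * exp (- g * q) * (C * exp (\<delta> / 2 * D))"
      using C D by (intro mult_left_mono) auto
    finally have "S\<^sup>2 * exp S \<le> 4 * a\<^sup>2 * exp (- g * q) * (C * exp (\<delta> / 2 * D)) * exp (\<delta> / 2 * D)"
      using S' C by (intro mult_mono) auto
    also have "\<dots> = ?c * exp (\<delta> / 2 * D + \<delta> / 2 * D)"
      by (simp only: exp_add mult.assoc)
    finally show ?thesis
      by (simp add: S_def D_def)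
  qed
  have "(\<integral>\<^sup>+\<omega>. ennreal (exp (offspring_weight (barrier_weight a \<theta> g L) J p m (mark N X \<omega> u))) \<partial>M)
    \<le> ennreal (1 + 2 * a * exp (- g * q) * m2 + 0 * m2 + ?c * K)"
    unfolding ow using a lap C expm f0 f1 second
    by (intro one_step_exp_moment[OF J, where ?t1.0 = g and ?t2.0 = g and \<delta> = \<delta>]) auto
  also have "\<dots> \<le> ennreal (exp (barrier_weight a \<theta> g L p m))"
  proof (rule ennreal_leI)
    have "?c * K = 2 * a * C * K * (2 * a * exp (- g * q))"
      by (simp add: power2_eq_square)
    also have "\<dots> \<le> (1 - m2) * (2 * a * exp (- g * q))"
      using small a by (intro mult_right_mono) auto
    finally have "1 + 2 * a * exp (- g * q) * m2 + 0 * m2 + ?c * K \<le> 1 + barrier_weight a \<theta> g L p m"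
      using pm by (simp add: barrier_weight_def q_def algebra_simps)
    also have "\<dots> \<le> exp (barrier_weight a \<theta> g L p m)"
      by (rule exp_ge_add_one_self)
    finally show "1 + 2 * a * exp (- g * q) * m2 + 0 * m2 + ?c * K \<le> exp (barrier_weight a \<theta> g L p m)" .
  qed
  finally show ?thesis .
qed

text \<open>For a negative running minimum the parent and all its children weigh 0, and both sides
  equal 1.\<close>

lemma subinvariant_killed_weight:
  fixes \<delta> K C a \<theta> m1 :: real
  assumes a: "0 < a" and "1 \<le> \<theta>" "\<theta> \<le> 2"
    and "laplace 1 = 1" "laplace \<theta> \<le> ennreal m1" "0 \<le> m1"
    and "(\<integral>\<^sup>+\<omega>. exp_ennreal (ennreal \<delta> * additive_martingale N X 1 \<omega>) \<partial>M) \<le> ennreal K"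
      "0 \<le> \<delta>" "0 \<le> K"
    and "0 < C" "\<And>t. 0 \<le> t \<Longrightarrow> t powr 2 \<le> C * exp (\<delta> / 2 * t)"
    and "4 * a \<le> \<delta>" "4 * a * C * K \<le> 1 - m1"
  shows "subinvariant (killed_weight a \<theta>)"
  unfolding subinvariant_def
proof (intro allI impI)
  fix u :: "nat list" and J :: "nat set" and p m :: real
  assume J: "finite J" and mp: "m \<le> p"
  show "(\<integral>\<^sup>+\<omega>. ennreal (exp (offspring_weight (killed_weight a \<theta>) J p m (mark N X \<omega> u))) \<partial>M)
    \<le> ennreal (exp (killed_weight a \<theta> p m))"
  proof (cases "0 \<le> m")
    case True
    then show ?thesis
      using assms J mp by (intro killed_weight_step[where \<delta> = \<delta> and K = K and C = C and ?m1.0 = m1]) auto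
  next
    case False
    then have "offspring_weight (killed_weight a \<theta>) J p m b = 0" for b
      by (auto simp: offspring_weight_def killed_weight_def intro!: sum.neutral)
    with False show ?thesis
      by (simp add: killed_weight_def emeasure_space_1)
  qed
qed

text \<open>Below the barrier the weights of parent and children are killed weights, whose
  subinvariance is assumed.\<close>

lemma subinvariant_barrier_weight:
  fixes \<delta> K C a \<theta> g L m2 :: real
  assumes sub: "subinvariant (killed_weight a \<theta>)"
    and "0 < a" "1 \<le> \<theta>" "1 \<le> g"
    and "laplace g \<le> ennreal m2" "0 \<le> m2"
    and "(\<integral>\<^sup>+\<omega>. exp_ennreal (ennreal \<delta> * additive_martingale N X 1 \<omega>) \<partial>M) \<le> ennreal K"
      "0 \<le> \<delta>" "0 \<le> K"
    and "0 < C" "\<And>t. 0 \<le> t \<Longrightarrow> t powr (g + 1) \<le> C * exp (\<delta> / 2 * t)"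
    and "4 * a \<le> \<delta>" "2 * a * C * K \<le> 1 - m2"
  shows "subinvariant (barrier_weight a \<theta> g L)"
  unfolding subinvariant_def
proof (intro allI impI)
  fix u :: "nat list" and J :: "nat set" and p m :: real
  assume J: "finite J" and mp: "m \<le> p"
  show "(\<integral>\<^sup>+\<omega>. ennreal (exp (offspring_weight (barrier_weight a \<theta> g L) J p m (mark N X \<omega> u))) \<partial>M)
    \<le> ennreal (exp (barrier_weight a \<theta> g L p m))"
  proof (cases "L \<le> m")
    case True
    then show ?thesis
      using assms J mp by (intro barrier_weight_step[where \<delta> = \<delta> and K = K and C = C and ?m2.0 = m2]) auto
  next
    case False
    then have "offspring_weight (barrier_weight a \<theta> g L) J p m b =
        offspring_weight (killed_weight a \<theta>) J p m b" for b
      by (auto simp: offspring_weight_def barrier_weight_def intro!: sum.cong)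
    with False show ?thesis
      using sub J mp by (simp add: barrier_weight_def subinvariant_def)
  qed
qed

end

section \<open>Tail estimates\<close>

definition truncated_weight :: "real \<Rightarrow> real \<Rightarrow> real" where
  "truncated_weight p m = (if 0 \<le> m then exp (- p) else 0)"

lemma measurable_truncated_weight:
  "(\<lambda>(p, m). truncated_weight p m) \<in> borel_measurable (borel \<Otimes>\<^sub>M borel)"
  unfolding truncated_weight_def by measurable

text \<open>If the path stays above \<open>L\<close>, shift the origin to \<open>L\<close> and take
  out \<open>exp (- L)\<close>; if it only stays above 0, the barrier weight is the killed weight,
  which dominates \<open>a * exp (- p)\<close>.\<close>

lemma truncated_weight_split:
  assumes a: "0 < a"
  shows "truncated_weight p m \<le>
    exp (- L) / a * killed_weight a \<theta> (p - L) (m - L) + barrier_weight a \<theta> g L p m / a"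
proof -
  have nonneg: "0 \<le> barrier_weight a \<theta> g L p m" "0 \<le> killed_weight a \<theta> (p - L) (m - L)"
    using a by (simp_all add: barrier_weight_def killed_weight_nonneg)
  consider "L \<le> m" "0 \<le> m" | "m < L" "0 \<le> m" | "m < 0"
    by linarith
  then show ?thesis
  proof cases
    case 1
    then have "exp (- L) / a * (a * exp (- (p - L))) \<le> exp (- L) / a * killed_weight a \<theta> (p - L) (m - L)"
      using a by (intro mult_left_mono killed_weight_ge) auto
    moreover have "exp (- L) / a * (a * exp (- (p - L))) = exp (- p)"
      using a by (simp flip: exp_add)
    ultimately show ?thesis
      using 1 a nonneg by (simp add: truncated_weight_def add_increasing2)
  next
    case 2
    then have "a * exp (- p) \<le> barrier_weight a \<theta> g L p m"
      using a by (simp add: barrier_weight_def killed_weight_ge)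
    then have "exp (- p) \<le> barrier_weight a \<theta> g L p m / a"
      using a by (simp add: field_simps)
    with 2 a nonneg show ?thesis
      by (simp add: truncated_weight_def add_increasing)
  next
    case 3
    with a nonneg show ?thesis
      by (simp add: truncated_weight_def)
  qed
qed

text \<open>\<open>S\<close> need not be measurable, as its measure is then \<open>0\<close>.\<close>

lemma (in prob_space) prob_le_of_incseq_cover:
  assumes E: "\<And>k. E k \<in> events" "incseq E" "\<And>k. prob (E k) \<le> c" and S: "S \<subseteq> (\<Union>k. E k)"
  shows "prob S \<le> c"
proof -
  have "prob S \<le> prob (\<Union>k. E k)"
    using E S by (intro finite_measure_mono) auto
  also have "\<dots> \<le> c"
  proof (rule LIMSEQ_le_const2)
    show "(\<lambda>k. prob (E k)) \<longlonglongrightarrow> prob (\<Union>k. E k)"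
      using E by (intro finite_Lim_measure_incseq) auto
  qed (use E in auto)
  finally show ?thesis .
qed

context branching_random_walk
begin

definition gen_sum :: "(real \<Rightarrow> real \<Rightarrow> real) \<Rightarrow> real \<Rightarrow> nat \<Rightarrow> nat \<Rightarrow> 'w \<Rightarrow> real" where
  "gen_sum w x n k \<omega> = (\<Sum>u\<in>words n k. weight w x N X u \<omega>)"

lemma measurable_gen_sum:
  assumes "(\<lambda>(p, m). w p m) \<in> borel_measurable (borel \<Otimes>\<^sub>M borel)"
  shows "gen_sum w x n k \<in> borel_measurable M"
  unfolding gen_sum_def[abs_def] using assms by (intro borel_measurable_sum measurable_weight')

lemma gen_sum_mono:
  assumes "\<And>p m. 0 \<le> w p m" "k \<le> l"
  shows "gen_sum w x n k \<omega> \<le> gen_sum w x n l \<omega>"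
  unfolding gen_sum_def using assms
  by (intro sum_mono2 words_mono) (auto simp: weight_def)

text \<open>Markov's inequality for \<open>exp Z - 1\<close> instead of \<open>exp Z\<close>: the
  bound then carries the initial weight \<open>w x x\<close> as a factor, which supplies the decay
  in \<open>x\<close>.\<close>

lemma prob_gen_sum_gt:
  assumes w: "(\<lambda>(p, m). w p m) \<in> borel_measurable (borel \<Otimes>\<^sub>M borel)"
    and sub: "subinvariant w" and nonneg: "\<And>p m. 0 \<le> w p m"
    and r: "w x x \<le> r" and b: "0 < b" "b \<le> t"
  shows "prob {\<omega> \<in> space M. t < gen_sum w x n k \<omega>} \<le> w x x * (exp r / (1 - exp (- b))) * exp (- t)"
proof -
  note [measurable] = measurable_gen_sum[OF w]
  let ?E = "{\<omega> \<in> space M. t < gen_sum w x n k \<omega>}"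
  have Z: "0 \<le> gen_sum w x n k \<omega>" for \<omega>
    using nonneg by (auto simp: gen_sum_def weight_def intro!: sum_nonneg)
  have int: "(\<integral>\<^sup>+\<omega>. ennreal (exp (gen_sum w x n k \<omega>)) \<partial>M) \<le> ennreal (exp (w x x))"
    unfolding gen_sum_def by (rule exp_moment_generation[OF w sub])
  have "1 + ennreal (exp t - 1) * emeasure M ?E = (\<integral>\<^sup>+\<omega>. 1 + ennreal (exp t - 1) * indicator ?E \<omega> \<partial>M)"
    by (simp add: nn_integral_add nn_integral_cmult emeasure_space_1)
  also have "\<dots> \<le> (\<integral>\<^sup>+\<omega>. ennreal (exp (gen_sum w x n k \<omega>)) \<partial>M)"
  proof (rule nn_integral_mono)
    fix \<omega>
    have "1 + (exp t - 1) * indicator ?E \<omega> \<le> exp (gen_sum w x n k \<omega>)"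
      using Z[of \<omega>] by (auto split: split_indicator)
    moreover have "1 + ennreal (exp t - 1) * indicator ?E \<omega> =
        ennreal (1 + (exp t - 1) * indicator ?E \<omega>)"
      using b by (simp add: ennreal_plus ennreal_mult ennreal_indicator)
    ultimately show "1 + ennreal (exp t - 1) * indicator ?E \<omega> \<le> ennreal (exp (gen_sum w x n k \<omega>))"
      by (simp only: ennreal_leI)
  qed
  also note int
  finally have "1 + (exp t - 1) * prob ?E \<le> exp (w x x)"
    using b by (simp add: emeasure_eq_measure flip: ennreal_mult ennreal_1 ennreal_plus)
  moreover have "exp (w x x) - 1 \<le> w x x * exp r"
  proof -
    have "1 - w x x \<le> exp (- w x x)"
      using exp_ge_add_one_self[of "- w x x"] by simp
    then have "(1 - w x x) * exp (w x x) \<le> exp (- w x x) * exp (w x x)"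
      by (rule mult_right_mono) simp
    then have "exp (w x x) - 1 \<le> w x x * exp (w x x)"
      by (simp add: algebra_simps flip: exp_add)
    also have "\<dots> \<le> w x x * exp r"
      using r nonneg by (intro mult_left_mono) auto
    finally show ?thesis .
  qed
  moreover have "(1 - exp (- b)) * exp t \<le> exp t - 1"
  proof -
    have "exp (- t) * exp t \<le> exp (- b) * exp t"
      using b by (intro mult_right_mono) auto
    then show ?thesis
      by (simp add: algebra_simps flip: exp_add)
  qed
  ultimately have "(1 - exp (- b)) * exp t * prob ?E \<le> w x x * exp r"
    by (smt (verit) measure_nonneg mult_right_mono)
  then show ?thesis
    using b by (simp add: field_simps exp_minus)
qed

lemma gen_sum_truncated_le:
  assumes "0 < a"
  shows "gen_sum truncated_weight x n k \<omega> \<le>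
    exp (- L) / a * gen_sum (killed_weight a \<theta>) (x - L) n k \<omega> +
    gen_sum (barrier_weight a \<theta> g L) x n k \<omega> / a"
  unfolding gen_sum_def sum_distrib_left sum_divide_distrib sum.distrib[symmetric]
proof (rule sum_mono)
  fix u
  show "weight truncated_weight x N X u \<omega> \<le> exp (- L) / a * weight (killed_weight a \<theta>) (x - L) N X u \<omega> +
      weight (barrier_weight a \<theta> g L) x N X u \<omega> / a"
    using truncated_weight_split[OF assms, of "x + pos X u \<omega>" "x + min_pos X u \<omega>" L \<theta> g]
    by (simp add: weight_def algebra_simps)
qed

lemma prob_truncated_gt:
  fixes a \<theta> g x y h r \<gamma> C :: real
  assumes a: "0 < a" and \<theta>: "1 \<le> \<theta>" and g: "1 \<le> g" "\<gamma> < g" and \<gamma>: "0 < \<gamma>"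
    and sub: "subinvariant (killed_weight a \<theta>)" "\<And>L. subinvariant (barrier_weight a \<theta> g L)"
    and C: "0 < C" "\<And>t. 0 \<le> t \<Longrightarrow> t powr g \<le> C * exp ((g - \<gamma>) * t)"
    and x: "0 < x" and y: "1 \<le> y"
  defines "h \<equiv> 2 * (\<gamma> + 1) / a"
  shows "prob {\<omega> \<in> space M. y < gen_sum truncated_weight x n k \<omega>} \<le>
    2 * a * exp (2 * a) * (1 / (1 - exp (- 1)) + h powr g * C * exp (g - \<gamma>) / (1 - exp (- (a / 2)))) *
      exp (- \<gamma> * x) * exp (- min 1 (a / 2) * y)"
proof -
  \<comment> \<open>With this choice \<open>a * exp L * y / 2\<close> equals
    \<open>(\<gamma> + 1) * (1 + x) * y\<close>, enough to pay for
    \<open>\<gamma> * x + y\<close>.\<close>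
  define L where "L = ln (h * (1 + x))"
  have h: "0 < h"
    using a \<gamma> by (simp add: h_def)
  then have L: "exp L = h * (1 + x)"
    using x by (simp add: L_def)
  let ?A = "{\<omega> \<in> space M. a * exp L * y / 2 < gen_sum (killed_weight a \<theta>) (x - L) n k \<omega>}"
  let ?B = "{\<omega> \<in> space M. a / 2 * y < gen_sum (barrier_weight a \<theta> g L) x n k \<omega>}"
  note [measurable] = measurable_gen_sum[OF measurable_killed_weight]
    measurable_gen_sum[OF measurable_barrier_weight]
  have killed: "killed_weight a \<theta> z z \<le> 2 * a" for z
  proof (cases "0 \<le> z")
    case True
    have "killed_weight a \<theta> z z \<le> 2 * a * exp (- z)"
      using a \<theta> by (intro killed_weight_le) auto
    also have "\<dots> \<le> 2 * a * 1"
      using a True by (intro mult_left_mono) auto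
    finally show ?thesis by simp
  qed (use a in \<open>simp add: killed_weight_def\<close>)
  have barrier: "barrier_weight a \<theta> g L x x \<le> 2 * a \<and>
      barrier_weight a \<theta> g L x x \<le> 2 * a * exp (- g * (x - L))"
  proof (cases "L \<le> x")
    case True
    have "2 * a * exp (- g * (x - L)) \<le> 2 * a * 1"
      using a g True by (intro mult_left_mono) auto
    with True show ?thesis
      by (simp add: barrier_weight_def)
  next
    case False
    have "2 * a * 1 \<le> 2 * a * exp (- g * (x - L))"
      using a g False by (intro mult_left_mono) (auto simp: mult_le_0_iff)
    with False killed[of x] show ?thesis
      by (simp add: barrier_weight_def)
  qed
  have tA: "\<gamma> * x + y \<le> a * exp L * y / 2"
  proof -
    have "a * exp L * y / 2 = (\<gamma> + 1) * (1 + x) * y"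
      using a by (simp add: L h_def field_simps)
    moreover have "\<gamma> * x * 1 \<le> \<gamma> * x * y"
      using \<gamma> x y by (intro mult_left_mono) auto
    moreover have "0 \<le> \<gamma> * y" "0 \<le> x * y"
      using \<gamma> x y by auto
    ultimately show ?thesis
      by (simp add: algebra_simps)
  qed
  have 1: "1 \<le> a * exp L * y / 2"
    using tA \<gamma> x y mult_pos_pos[of \<gamma> x] by linarith
  \<comment> \<open>The lower bound \<open>b\<close> on the threshold is 1 here and
    \<open>a / 2\<close> for \<open>?B\<close>; both come from \<open>y\<close> being at least
    1.\<close>
  have "prob ?A \<le> killed_weight a \<theta> (x - L) (x - L) * (exp (2 * a) / (1 - exp (- 1))) * exp (- (a * exp L * y / 2))"
    using a killed 1
    by (intro prob_gen_sum_gt measurable_killed_weight sub killed_weight_nonneg) auto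
  also have "\<dots> \<le> 2 * a * (exp (2 * a) / (1 - exp (- 1))) * exp (- (\<gamma> * x + min 1 (a / 2) * y))"
  proof (intro mult_mono killed)
    have "min 1 (a / 2) * y \<le> 1 * y"
      using y by (intro mult_right_mono) auto
    with tA show "exp (- (a * exp L * y / 2)) \<le> exp (- (\<gamma> * x + min 1 (a / 2) * y))"
      by simp
  qed (use a killed_weight_nonneg[of a] in auto)
  also have "exp (- (\<gamma> * x + min 1 (a / 2) * y)) = exp (- \<gamma> * x) * exp (- min 1 (a / 2) * y)"
    by (simp flip: exp_add)
  finally have A: "prob ?A \<le>
      2 * a * exp (2 * a) * (1 / (1 - exp (- 1))) * exp (- \<gamma> * x) * exp (- min 1 (a / 2) * y)"
    by (simp only: times_divide_eq_right mult_1_right mult.assoc)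
  have b0: "0 \<le> barrier_weight a \<theta> g L p m" for p m
    using a by (simp add: barrier_weight_def killed_weight_nonneg)
  \<comment> \<open>The barrier costs only a power of \<open>1 + x\<close>, which the gap between
    \<open>g\<close> and \<open>\<gamma>\<close> absorbs.\<close>
  have "exp (- g * (x - L)) = (h * (1 + x)) powr g * exp (- g * x)"
    unfolding L[symmetric] by (simp add: exp_powr_real algebra_simps flip: exp_add)
  also have "\<dots> \<le> h powr g * (C * exp ((g - \<gamma>) * (1 + x))) * exp (- g * x)"
    using h x C by (simp add: powr_mult mult_left_mono)
  also have "\<dots> = h powr g * C * exp (g - \<gamma>) * exp (- \<gamma> * x)"
    by (simp add: algebra_simps flip: exp_add)
  finally have gL: "exp (- g * (x - L)) \<le> h powr g * C * exp (g - \<gamma>) * exp (- \<gamma> * x)" .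
  have "prob ?B \<le> barrier_weight a \<theta> g L x x * (exp (2 * a) / (1 - exp (- (a / 2)))) * exp (- (a / 2 * y))"
    using a y barrier b0 by (intro prob_gen_sum_gt measurable_barrier_weight sub) auto
  also have "\<dots> \<le> 2 * a * (h powr g * C * exp (g - \<gamma>) * exp (- \<gamma> * x)) * (exp (2 * a) / (1 - exp (- (a / 2)))) *
      exp (- min 1 (a / 2) * y)"
  proof (intro mult_mono)
    have "2 * a * exp (- g * (x - L)) \<le> 2 * a * (h powr g * C * exp (g - \<gamma>) * exp (- \<gamma> * x))"
      using a gL by (intro mult_left_mono) auto
    with barrier show "barrier_weight a \<theta> g L x x \<le> 2 * a * (h powr g * C * exp (g - \<gamma>) * exp (- \<gamma> * x))"
      by linarith
    have "min 1 (a / 2) * y \<le> a / 2 * y"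
      using y by (intro mult_right_mono) auto
    then show "exp (- (a / 2 * y)) \<le> exp (- min 1 (a / 2) * y)"
      by simp
  qed (use a b0 C h in auto)
  finally have B: "prob ?B \<le> 2 * a * exp (2 * a) * (h powr g * C * exp (g - \<gamma>) / (1 - exp (- (a / 2)))) *
      exp (- \<gamma> * x) * exp (- min 1 (a / 2) * y)"
    by (simp add: mult_ac)
  \<comment> \<open>If the sum of the two parts exceeds \<open>y\<close>, one of them exceeds
    \<open>y / 2\<close>.\<close>
  have "{\<omega> \<in> space M. y < gen_sum truncated_weight x n k \<omega>} \<subseteq> ?A \<union> ?B"
  proof clarsimp
    fix \<omega>
    let ?KA = "gen_sum (killed_weight a \<theta>) (x - L) n k \<omega>"
    let ?KB = "gen_sum (barrier_weight a \<theta> g L) x n k \<omega>"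
    assume "y < gen_sum truncated_weight x n k \<omega>" and KB: "\<not> a * y < ?KB * 2"
    then have "y < exp (- L) / a * ?KA + ?KB / a"
      using gen_sum_truncated_le[OF a, of x n k \<omega> L \<theta> g] by linarith
    moreover have "?KB / a \<le> y / 2"
      using KB a by (simp add: field_simps)
    ultimately have "y / 2 < exp (- L) / a * ?KA"
      by linarith
    then have "a * exp L * (y / 2) < a * exp L * (exp (- L) / a * ?KA)"
      using a by (intro mult_strict_left_mono) auto
    also have "\<dots> = ?KA"
      using a by (simp add: exp_minus)
    finally show "a * exp L * y < ?KA * 2"
      by simp
  qed
  then have "prob {\<omega> \<in> space M. y < gen_sum truncated_weight x n k \<omega>} \<le> prob (?A \<union> ?B)"
    by (intro finite_measure_mono) auto
  also have "\<dots> \<le> prob ?A + prob ?B"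
    by (intro measure_Un_le) auto
  also note add_mono[OF A B]
  finally show ?thesis
    by (simp add: algebra_simps)
qed

section \<open>From finite windows to the martingale and its limit\<close>

lemma truncated_martingale_eq:
  "truncated_martingale N X x n \<omega> =
    (\<Sum>\<^sub>\<infinity>u\<in>generation N n \<omega>. ennreal (weight truncated_weight x N X u \<omega>))"
  unfolding truncated_martingale_def
  by (rule infsum_cong) (auto simp: weight_def truncated_weight_def generation_def)

lemma truncated_weight_nonneg: "0 \<le> truncated_weight p m"
  by (simp add: truncated_weight_def)

text \<open>A non-negative infinite sum is the supremum of its finite partial sums, and a finite set
  of labels lies in one window.\<close>

lemma less_truncated_martingaleD:
  assumes "ennreal y < truncated_martingale N X x n \<omega>" "0 \<le> y"
  shows "\<exists>k. y < gen_sum truncated_weight x n k \<omega>"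
proof -
  have nonneg: "0 \<le> weight truncated_weight x N X u \<omega>" for u
    by (simp add: weight_def truncated_weight_nonneg)
  from assms obtain F where F: "finite F" "F \<subseteq> generation N n \<omega>"
    and "ennreal y < (\<Sum>u\<in>F. ennreal (weight truncated_weight x N X u \<omega>))"
    unfolding truncated_martingale_eq
    by (subst (asm) nonneg_infsum_complete) (auto simp: less_SUP_iff)
  then have "y < (\<Sum>u\<in>F. weight truncated_weight x N X u \<omega>)"
    using nonneg assms by (simp add: sum_ennreal ennreal_less_iff)
  moreover obtain k where "F \<subseteq> words n k"
    using F by (auto simp: generation_def intro: finite_subset_words[of F n])
  then have "(\<Sum>u\<in>F. weight truncated_weight x N X u \<omega>) \<le> gen_sum truncated_weight x n k \<omega>"
    unfolding gen_sum_def using nonneg by (intro sum_mono2) auto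
  ultimately show ?thesis
    by (meson less_le_trans)
qed

lemma prob_truncated_martingale_ext_gt:
  assumes bound: "\<And>n k. prob {\<omega> \<in> space M. y < gen_sum truncated_weight x n k \<omega>} \<le> c" and y: "0 \<le> y"
  shows "prob {\<omega> \<in> space M. ennreal y < truncated_martingale_ext N X x n \<omega>} \<le> c"
proof -
  note [measurable] = measurable_gen_sum[OF measurable_truncated_weight]
  define E where "E n k = {\<omega> \<in> space M. y < gen_sum truncated_weight x n k \<omega>}" for n k
  have E [measurable]: "E n k \<in> events" for n k
    unfolding E_def by measurable
  have bound': "prob S \<le> c" if "S \<subseteq> (\<Union>k. E n k)" for S n
  proof (rule prob_le_of_incseq_cover[OF E _ _ that])
    show "incseq (E n)"
      unfolding E_def
      by (auto simp: incseq_def intro: less_le_trans gen_sum_mono truncated_weight_nonneg)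
    show "prob (E n k) \<le> c" for k
      unfolding E_def by (rule bound)
  qed
  have finite_n: "\<omega> \<in> (\<Union>k. E n k)"
    if "\<omega> \<in> space M" "ennreal y < truncated_martingale N X x n \<omega>" for n \<omega>
    using less_truncated_martingaleD[OF that(2) y] that(1) by (auto simp: E_def)
  show ?thesis
  proof (cases n)
    case (enat n')
    then show ?thesis
      by (intro bound'[of _ n']) (auto simp: truncated_martingale_ext_def dest: finite_n)
  next
    case infinity
    \<comment> \<open>If the limit exceeds \<open>y\<close>, so do all late terms. Each
      \<open>?G j\<close> lies in the event for generation \<open>j\<close> alone, and the
      \<open>?G j\<close> increase with \<open>j\<close>.\<close>
    let ?G = "\<lambda>j. \<Inter>n\<in>{j..}. \<Union>k. E n k"
    have "\<omega> \<in> (\<Union>j. ?G j)"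
      if \<omega>: "\<omega> \<in> space M" and gt: "ennreal y < truncated_martingale_ext N X x \<infinity> \<omega>" for \<omega>
    proof -
      let ?W = "\<lambda>n. truncated_martingale N X x n \<omega>"
      \<comment> \<open>The default value 0 cannot exceed \<open>ennreal y\<close>, so convergence
        holds at this \<open>\<omega>\<close>.\<close>
      from gt have "convergent ?W" and lim: "ennreal y < lim ?W"
        by (auto simp: truncated_martingale_ext_def split: if_splits)
      then have "?W \<longlonglongrightarrow> lim ?W"
        by (simp add: convergent_LIMSEQ_iff)
      then have "eventually (\<lambda>n. ennreal y < ?W n) sequentially"
        using lim by (rule order_tendstoD)
      then obtain j where "\<And>n. j \<le> n \<Longrightarrow> ennreal y < ?W n"
        by (auto simp: eventually_sequentially)
      then have "\<omega> \<in> ?G j"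
        using finite_n[OF \<omega>] by blast
      then show ?thesis
        by blast
    qed
    then have cover: "{\<omega> \<in> space M. ennreal y < truncated_martingale_ext N X x n \<omega>} \<subseteq> (\<Union>j. ?G j)"
      using infinity by blast
    show ?thesis
    proof (rule prob_le_of_incseq_cover[OF _ _ _ cover])
      show "?G j \<in> events" for j
        by measurable
      show "incseq ?G"
        by (intro monoI INF_superset_mono) auto
      show "prob (?G j) \<le> c" for j
        by (rule bound'[of _ j]) auto
    qed
  qed
qed

end

theorem theorem1p1:
  fixes M :: "'w measure" and Q :: "'v measure"
    and N :: "nat list \<Rightarrow> 'w \<Rightarrow> enat"
    and X :: "nat list \<Rightarrow> nat \<Rightarrow> 'w \<Rightarrow> real"
    and \<Xi> :: "'v \<Rightarrow> real measure"
    and d \<gamma> :: real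
  assumes brw: "branching_random_walk M N X Q \<Xi>"
    and Phi_0: "0 < log_laplace M N X 0"
    and Phi_1: "log_laplace M N X 1 = 0"
    and Phi_finite: "\<forall>\<^sub>F \<theta> in nhds 1. \<bar>log_laplace M N X \<theta>\<bar> \<noteq> \<infinity>"
    and Phi_deriv: "((\<lambda>\<theta>. real_of_ereal (log_laplace M N X \<theta>)) has_real_derivative d) (at 1)"
    and Phi_deriv_neg: "d < 0"
    and gamma: "1 < \<gamma>" "ereal \<gamma> < kappa M N X"
    and exp_moment:
      "\<exists>\<delta>>0. (\<integral>\<^sup>+\<omega>. exp_ennreal (ennreal \<delta> * additive_martingale N X 1 \<omega>) \<partial>M) < \<infinity>"
  shows "\<exists>C>0. \<exists>c>0. \<forall>x>0. \<forall>y\<ge>1. \<forall>n::enat.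
           measure M {\<omega> \<in> space M. ennreal y < truncated_martingale_ext N X x n \<omega>}
             \<le> C * exp (- \<gamma> * x) * exp (- c * y)"
proof -
  interpret branching_random_walk M N X Q \<Xi>
    by (rule brw)
  have laplace_1: "laplace 1 = 1"
    using Phi_1 by (simp add: log_laplace_eq ln_ennreal_eq_0)
  \<comment> \<open>Below the infimum \<open>kappa\<close> no exponent above 1 has non-negative
    log-Laplace transform; the real number \<open>m\<close> records the strict contraction.\<close>
  have laplace_less: "\<exists>m. 0 \<le> m \<and> m < 1 \<and> laplace \<theta> \<le> ennreal m"
    if "1 < \<theta>" "ereal \<theta> < kappa M N X" for \<theta>
  proof -
    have "\<not> 0 \<le> log_laplace M N X \<theta>"
    proof
      assume "0 \<le> log_laplace M N X \<theta>"
      with that have "kappa M N X \<le> ereal \<theta>"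
        unfolding kappa_def by (intro INF_lower) auto
      with that show False
        by simp
    qed
    then have "laplace \<theta> < 1"
      by (simp add: log_laplace_eq not_le ln_ennreal_neg)
    then show ?thesis
      by (intro exI[of _ "enn2real (laplace \<theta>)"]) (cases "laplace \<theta>"; auto simp: ennreal_less_one_iff)
  qed
  \<comment> \<open>The exponent must lie between 1 and \<open>kappa\<close> for the drift and be at
    most 2 to absorb the second-order term.\<close>
  define \<theta> where "\<theta> = min 2 \<gamma>"
  have \<theta>: "1 < \<theta>" "\<theta> \<le> 2" "ereal \<theta> < kappa M N X"
    using gamma by (auto simp: \<theta>_def min_def intro: le_less_trans[of _ "ereal \<gamma>"])
  obtain g where g: "\<gamma> < g" "ereal g < kappa M N X"
    using ereal_dense2[OF gamma(2)] by auto
  obtain m1 where m1: "0 \<le> m1" "m1 < 1" "laplace \<theta> \<le> ennreal m1"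
    using laplace_less[OF \<theta>(1,3)] by auto
  obtain m2 where m2: "0 \<le> m2" "m2 < 1" "laplace g \<le> ennreal m2"
    using laplace_less[of g] g gamma by auto
  obtain \<delta> where \<delta>: "0 < \<delta>"
    and "(\<integral>\<^sup>+\<omega>. exp_ennreal (ennreal \<delta> * additive_martingale N X 1 \<omega>) \<partial>M) < \<infinity>"
    using exp_moment by auto
  then obtain K0 where "0 \<le> K0"
    and "(\<integral>\<^sup>+\<omega>. exp_ennreal (ennreal \<delta> * additive_martingale N X 1 \<omega>) \<partial>M) = ennreal K0"
    by (cases "(\<integral>\<^sup>+\<omega>. exp_ennreal (ennreal \<delta> * additive_martingale N X 1 \<omega>) \<partial>M)") auto
  then obtain K where K: "0 < K"
    "(\<integral>\<^sup>+\<omega>. exp_ennreal (ennreal \<delta> * additive_martingale N X 1 \<omega>) \<partial>M) \<le> ennreal K"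
    by (metis add_pos_nonneg ennreal_leI le_add_same_cancel2 add.commute zero_less_one zero_le_one)
  obtain C2 where C2: "0 < C2" "\<And>t. 0 \<le> t \<Longrightarrow> t powr 2 \<le> C2 * exp (\<delta> / 2 * t)"
    using powr_le_exp[of 2 "\<delta> / 2"] \<delta> by auto
  obtain C3 where C3: "0 < C3" "\<And>t. 0 \<le> t \<Longrightarrow> t powr (g + 1) \<le> C3 * exp (\<delta> / 2 * t)"
    using powr_le_exp[of "g + 1" "\<delta> / 2"] \<delta> g gamma by auto
  obtain C4 where C4: "0 < C4" "\<And>t. 0 \<le> t \<Longrightarrow> t powr g \<le> C4 * exp ((g - \<gamma>) * t)"
    using powr_le_exp[of g "g - \<gamma>"] g gamma by auto
  \<comment> \<open>The first entry keeps the total weight within half of the exponential moment;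
    the other two let the drifts cover the second-order terms of the killed and the barrier
    weight.\<close>
  define a where "a = min (\<delta> / 4) (min ((1 - m1) / (4 * C2 * K)) ((1 - m2) / (2 * C3 * K)))"
  have a: "0 < a"
    using \<delta> m1 m2 C2 C3 K by (simp add: a_def)
  have small: "4 * a \<le> \<delta>" "4 * a * C2 * K \<le> 1 - m1" "2 * a * C3 * K \<le> 1 - m2"
  proof -
    have "a \<le> \<delta> / 4" "a \<le> (1 - m1) / (4 * C2 * K)" "a \<le> (1 - m2) / (2 * C3 * K)"
      by (simp_all add: a_def)
    then show "4 * a \<le> \<delta>" "4 * a * C2 * K \<le> 1 - m1" "2 * a * C3 * K \<le> 1 - m2"
      using C2 C3 K by (simp_all add: pos_le_divide_eq mult_ac)
  qed
  have killed: "subinvariant (killed_weight a \<theta>)"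
    using a \<theta> laplace_1 m1 K \<delta> C2 small
    by (intro subinvariant_killed_weight[where \<delta> = \<delta> and K = K and C = C2 and ?m1.0 = m1]) auto
  \<comment> \<open>One \<open>a\<close> serves every \<open>L\<close>. This uniformity matters
    because the barrier will move with \<open>x\<close>.\<close>
  have barrier: "subinvariant (barrier_weight a \<theta> g L)" for L
    using a \<theta> g gamma m2 K \<delta> C3 small
    by (intro subinvariant_barrier_weight[OF killed, where \<delta> = \<delta> and K = K and C = C3 and ?m2.0 = m2]) auto
  define h where "h = 2 * (\<gamma> + 1) / a"
  define C where "C = 2 * a * exp (2 * a) *
    (1 / (1 - exp (- 1)) + h powr g * C4 * exp (g - \<gamma>) / (1 - exp (- (a / 2))))"
  have "0 < C"
    unfolding C_def using a C4 by (intro mult_pos_pos add_pos_nonneg divide_nonneg_pos) auto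
  moreover have "0 < min 1 (a / 2)"
    using a by simp
  moreover have "prob {\<omega> \<in> space M. ennreal y < truncated_martingale_ext N X x n \<omega>}
      \<le> C * exp (- \<gamma> * x) * exp (- min 1 (a / 2) * y)" if "0 < x" "1 \<le> y" for x y n
    unfolding C_def h_def using that a \<theta> g gamma killed barrier C4
    by (intro prob_truncated_martingale_ext_gt prob_truncated_gt) auto
  ultimately show ?thesis
    by blast
qed

end
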